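(* Let $(X,\mu,\mathcal{E},\mathcal{F})$ be a Dirichlet space whose heat semigroup $\{P_t\}_{t\in[0,\infty)}$ is conservative. Then $\mathbf B^{2,1/2}(X)=\mathcal F$. Moreover, for every $f\in\mathcal F$, $$2\,\mathcal E(f,f)=\|f\|_{2,1/2}^2 .$$
   Context: $X$ is a good measurable space (the measure decomposition theorem holds and the $\sigma$-algebra is generated by a countable family; e.g. a Polish space) with a $\sigma$-finite measure $\mu$. A Dirichlet form is a densely defined closed symmetric form $(\mathcal{E},\mathcal{F})$ on $L^2(X,\mu)$ which is Markovian: if $u\in\mathcal F$ and $v$ satisfies $|v(x)-v(y)|\le|u(x)-u(y)|$ and $|v(x)|\le|u(x)|$ for a.e. $x,y$, then $v\in\mathcal F$ and $\mathcal E(v,v)\le\mathcal E(u,u)$. Then $(X,\mu,\mathcal E,\mathcal F)$ is called a Dirichlet space. $\{P_t\}_{t\ge0}$ is the associated self-adjoint sub-Markovian semigroup on $L^2(X,\mu)$ (the heat semigroup), extended to a contraction semigroup on every $L^p(X,\mu)$, $1\le p\le\infty$. It is conservative if $P_t1=1$ for all $t$; then there are probability kernels $p_t(x,dy)$ with $P_tf(x)=\int_Xf(y)\,p_t(x,dy)$ for bounded or non-negative measurable $f$. For $p\ge1$, $\alpha\ge0$, $f\in L^p(X,\mu)$, $$\|f\|_{p,\alpha}=\sup_{t>0}t^{-\alpha}\left(\int_XP_t(|f-f(y)|^p)(y)\,d\mu(y)\right)^{1/p}=\sup_{t>0}t^{-\alpha}\left(\int_X\int_X|f(x)-f(y)|^p\,p_t(y,dx)\,d\mu(y)\right)^{1/p},$$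 and $\mathbf B^{p,\alpha}(X)=\{f\in L^p(X,\mu):\|f\|_{p,\alpha}<+\infty\}$. *)

theory Defs
  imports "HOL-Probability.Probability"
begin

definition good_measurable_space :: "'a measure \<Rightarrow> bool" where
  "good_measurable_space M \<longleftrightarrow>
     (\<exists>G. countable G \<and> G \<subseteq> Pow (space M) \<and> sets M = sigma_sets (space M) G) \<and>
     (\<forall>\<pi>. sets \<pi> = sets (M \<Otimes>\<^sub>M M) \<and> finite_measure \<pi> \<longrightarrow>
        (\<exists>K \<in> M \<rightarrow>\<^sub>M prob_algebra M. \<forall>A \<in> sets M. \<forall>B \<in> sets M.
           emeasure \<pi> (A \<times> B) = (\<integral>\<^sup>+x\<in>A. emeasure (K x) B \<partial>distr \<pi> M fst)))"

text \<open>
  Elements of \<open>L\<^sup>p\<close> are represented by measurable functions. Sets of functions below are closed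
  under almost everywhere equality, and maps on functions respect it, so that everything
  descends to equivalence classes.
\<close>

definition Lp :: "'a measure \<Rightarrow> real \<Rightarrow> ('a \<Rightarrow> real) set" where
  "Lp M p = {f \<in> borel_measurable M. integrable M (\<lambda>x. \<bar>f x\<bar> powr p)}"

definition L2_inner :: "'a measure \<Rightarrow> ('a \<Rightarrow> real) \<Rightarrow> ('a \<Rightarrow> real) \<Rightarrow> real" where
  "L2_inner M f g = (\<integral>x. f x * g x \<partial>M)"

definition L2_norm :: "'a measure \<Rightarrow> ('a \<Rightarrow> real) \<Rightarrow> real" where
  "L2_norm M f = sqrt (L2_inner M f f)"

definition symmetric_form ::
  "'a measure \<Rightarrow> (('a \<Rightarrow> real) \<Rightarrow> ('a \<Rightarrow> real) \<Rightarrow> real) \<Rightarrow> ('a \<Rightarrow> real) set \<Rightarrow> bool" where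
  "symmetric_form M E F \<longleftrightarrow>
     F \<subseteq> Lp M 2 \<and>
     (\<forall>f\<in>F. \<forall>g\<in>borel_measurable M. (AE x in M. f x = g x) \<longrightarrow> g \<in> F \<and> (\<forall>h\<in>F. E f h = E g h)) \<and>
     (\<lambda>x. 0) \<in> F \<and>
     (\<forall>f\<in>F. \<forall>g\<in>F. (\<lambda>x. f x + g x) \<in> F) \<and>
     (\<forall>f\<in>F. \<forall>c. (\<lambda>x. c * f x) \<in> F) \<and>
     (\<forall>f\<in>F. \<forall>g\<in>F. \<forall>h\<in>F. E (\<lambda>x. f x + g x) h = E f h + E g h) \<and>
     (\<forall>f\<in>F. \<forall>h\<in>F. \<forall>c. E (\<lambda>x. c * f x) h = c * E f h) \<and>
     (\<forall>f\<in>F. \<forall>g\<in>F. E f g = E g f) \<and>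
     (\<forall>f\<in>F. 0 \<le> E f f)"

definition densely_defined :: "'a measure \<Rightarrow> ('a \<Rightarrow> real) set \<Rightarrow> bool" where
  "densely_defined M F \<longleftrightarrow>
     (\<forall>f\<in>Lp M 2. \<forall>\<epsilon>>0. \<exists>g\<in>F. L2_norm M (\<lambda>x. f x - g x) < \<epsilon>)"

definition form_energy ::
  "'a measure \<Rightarrow> (('a \<Rightarrow> real) \<Rightarrow> ('a \<Rightarrow> real) \<Rightarrow> real) \<Rightarrow> ('a \<Rightarrow> real) \<Rightarrow> real" where
  "form_energy M E f = E f f + L2_inner M f f"

definition closed_form ::
  "'a measure \<Rightarrow> (('a \<Rightarrow> real) \<Rightarrow> ('a \<Rightarrow> real) \<Rightarrow> real) \<Rightarrow> ('a \<Rightarrow> real) set \<Rightarrow> bool" where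
  "closed_form M E F \<longleftrightarrow>
     (\<forall>u :: nat \<Rightarrow> 'a \<Rightarrow> real. range u \<subseteq> F \<and>
        (\<forall>\<epsilon>>0. \<exists>N. \<forall>m\<ge>N. \<forall>n\<ge>N. form_energy M E (\<lambda>x. u m x - u n x) < \<epsilon>) \<longrightarrow>
        (\<exists>v\<in>F. (\<lambda>n. form_energy M E (\<lambda>x. u n x - v x)) \<longlonglongrightarrow> 0))"

definition markovian_form ::
  "'a measure \<Rightarrow> (('a \<Rightarrow> real) \<Rightarrow> ('a \<Rightarrow> real) \<Rightarrow> real) \<Rightarrow> ('a \<Rightarrow> real) set \<Rightarrow> bool" where
  "markovian_form M E F \<longleftrightarrow>
     (\<forall>u\<in>F. \<forall>v\<in>borel_measurable M.
        (AE (x, y) in M \<Otimes>\<^sub>M M. \<bar>v x - v y\<bar> \<le> \<bar>u x - u y\<bar>) \<and>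
        (AE x in M. \<bar>v x\<bar> \<le> \<bar>u x\<bar>) \<longrightarrow>
        v \<in> F \<and> E v v \<le> E u u)"

definition dirichlet_form ::
  "'a measure \<Rightarrow> (('a \<Rightarrow> real) \<Rightarrow> ('a \<Rightarrow> real) \<Rightarrow> real) \<Rightarrow> ('a \<Rightarrow> real) set \<Rightarrow> bool" where
  "dirichlet_form M E F \<longleftrightarrow>
     symmetric_form M E F \<and> densely_defined M F \<and> closed_form M E F \<and> markovian_form M E F"

definition dirichlet_space ::
  "'a measure \<Rightarrow> (('a \<Rightarrow> real) \<Rightarrow> ('a \<Rightarrow> real) \<Rightarrow> real) \<Rightarrow> ('a \<Rightarrow> real) set \<Rightarrow> bool" where
  "dirichlet_space M E F \<longleftrightarrow>
     good_measurable_space M \<and> sigma_finite_measure M \<and> dirichlet_form M E F"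

definition symmetric_contraction_semigroup ::
  "'a measure \<Rightarrow> (real \<Rightarrow> ('a \<Rightarrow> real) \<Rightarrow> 'a \<Rightarrow> real) \<Rightarrow> bool" where
  "symmetric_contraction_semigroup M P \<longleftrightarrow>
     (\<forall>t\<ge>0. \<forall>f\<in>Lp M 2. P t f \<in> Lp M 2 \<and> L2_norm M (P t f) \<le> L2_norm M f) \<and>
     (\<forall>t\<ge>0. \<forall>f\<in>Lp M 2. \<forall>g\<in>Lp M 2. (AE x in M. f x = g x) \<longrightarrow> (AE x in M. P t f x = P t g x)) \<and>
     (\<forall>t\<ge>0. \<forall>f\<in>Lp M 2. \<forall>g\<in>Lp M 2. AE x in M. P t (\<lambda>y. f y + g y) x = P t f x + P t g x) \<and>
     (\<forall>t\<ge>0. \<forall>f\<in>Lp M 2. \<forall>c. AE x in M. P t (\<lambda>y. c * f y) x = c * P t f x) \<and>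
     (\<forall>t\<ge>0. \<forall>f\<in>Lp M 2. \<forall>g\<in>Lp M 2. L2_inner M (P t f) g = L2_inner M f (P t g)) \<and>
     (\<forall>f\<in>Lp M 2. AE x in M. P 0 f x = f x) \<and>
     (\<forall>s\<ge>0. \<forall>t\<ge>0. \<forall>f\<in>Lp M 2. AE x in M. P (s + t) f x = P s (P t f) x) \<and>
     (\<forall>f\<in>Lp M 2. ((\<lambda>t. L2_norm M (\<lambda>x. P t f x - f x)) \<longlongrightarrow> 0) (at_right 0))"

text \<open>The graph of the infinitesimal generator of the semigroup.\<close>

definition semigroup_generator ::
  "'a measure \<Rightarrow> (real \<Rightarrow> ('a \<Rightarrow> real) \<Rightarrow> 'a \<Rightarrow> real) \<Rightarrow> (('a \<Rightarrow> real) \<times> ('a \<Rightarrow> real)) set" where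
  "semigroup_generator M P =
     {(f, g). f \<in> Lp M 2 \<and> g \<in> Lp M 2 \<and>
        ((\<lambda>t. L2_norm M (\<lambda>x. (P t f x - f x) / t - g x)) \<longlongrightarrow> 0) (at_right 0)}"

text \<open>
  The graph of the self-adjoint operator \<open>L\<close> associated with the form:
  \<open>E f v = - \<langle>L f, v\<rangle>\<close> for all \<open>v\<close> in the form domain.
\<close>

definition form_generator ::
  "'a measure \<Rightarrow> (('a \<Rightarrow> real) \<Rightarrow> ('a \<Rightarrow> real) \<Rightarrow> real) \<Rightarrow> ('a \<Rightarrow> real) set
     \<Rightarrow> (('a \<Rightarrow> real) \<times> ('a \<Rightarrow> real)) set" where
  "form_generator M E F = {(f, g). f \<in> F \<and> g \<in> Lp M 2 \<and> (\<forall>v\<in>F. E f v = - L2_inner M g v)}"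

definition heat_semigroup ::
  "'a measure \<Rightarrow> (('a \<Rightarrow> real) \<Rightarrow> ('a \<Rightarrow> real) \<Rightarrow> real) \<Rightarrow> ('a \<Rightarrow> real) set
     \<Rightarrow> (real \<Rightarrow> ('a \<Rightarrow> real) \<Rightarrow> 'a \<Rightarrow> real) \<Rightarrow> bool" where
  "heat_semigroup M E F P \<longleftrightarrow>
     symmetric_contraction_semigroup M P \<and> semigroup_generator M P = form_generator M E F"

text \<open>
  The extension of \<open>P t\<close> beyond \<open>L\<^sup>2\<close>, on non-negative functions: \<open>P t f = h\<close> almost everywhere,
  where \<open>P t f\<close> is the monotone limit of \<open>P t (u n)\<close> for non-negative \<open>u n\<close> in \<open>L\<^sup>2\<close> increasing
  to \<open>f\<close>. Such sequences exist when \<open>M\<close> is \<open>\<sigma>\<close>-finite, and the limit does not depend on the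
  sequence when \<open>P\<close> is the heat semigroup of a Dirichlet form, since \<open>P t\<close> is then positivity
  preserving. On non-negative elements of \<open>L\<^sup>p\<close>, \<open>1 \<le> p \<le> \<infinity>\<close>, it is the usual extension.
\<close>

definition extended_semigroup ::
  "'a measure \<Rightarrow> (real \<Rightarrow> ('a \<Rightarrow> real) \<Rightarrow> 'a \<Rightarrow> real) \<Rightarrow> real
     \<Rightarrow> ('a \<Rightarrow> ennreal) \<Rightarrow> ('a \<Rightarrow> ennreal) \<Rightarrow> bool" where
  "extended_semigroup M P t f h \<longleftrightarrow>
     (\<forall>u :: nat \<Rightarrow> 'a \<Rightarrow> real.
        range u \<subseteq> Lp M 2 \<and> (\<forall>n. \<forall>x\<in>space M. 0 \<le> u n x \<and> u n x \<le> u (Suc n) x) \<and>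
        (\<forall>x\<in>space M. (SUP n. ennreal (u n x)) = f x) \<longrightarrow>
        (AE x in M. (SUP n. ennreal (P t (u n) x)) = h x))"

definition conservative_semigroup ::
  "'a measure \<Rightarrow> (real \<Rightarrow> ('a \<Rightarrow> real) \<Rightarrow> 'a \<Rightarrow> real) \<Rightarrow> bool" where
  "conservative_semigroup M P \<longleftrightarrow> (\<forall>t\<ge>0. extended_semigroup M P t (\<lambda>x. 1) (\<lambda>x. 1))"

text \<open>
  \<open>p t x\<close> is the measure \<open>p\<^sub>t(x, dy)\<close>. For bounded functions of variable sign the representation
  follows by splitting into positive and negative parts.
\<close>

definition heat_kernel ::
  "'a measure \<Rightarrow> (real \<Rightarrow> ('a \<Rightarrow> real) \<Rightarrow> 'a \<Rightarrow> real) \<Rightarrow> (real \<Rightarrow> 'a \<Rightarrow> 'a measure) \<Rightarrow> bool" where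
  "heat_kernel M P p \<longleftrightarrow>
     (\<forall>t\<ge>0. p t \<in> M \<rightarrow>\<^sub>M prob_algebra M \<and>
        (\<forall>f\<in>borel_measurable M. extended_semigroup M P t f (\<lambda>x. \<integral>\<^sup>+y. f y \<partial>p t x)))"

text \<open>Powers \<open>x\<^sup>a\<close> with real exponent \<open>a > 0\<close> on \<open>[0, \<infinity>]\<close>.\<close>

definition ennreal_powr :: "ennreal \<Rightarrow> real \<Rightarrow> ennreal" where
  "ennreal_powr x a = (if x = \<infinity> then \<infinity> else ennreal (enn2real x powr a))"

definition besov_seminorm ::
  "'a measure \<Rightarrow> (real \<Rightarrow> 'a \<Rightarrow> 'a measure) \<Rightarrow> real \<Rightarrow> real \<Rightarrow> ('a \<Rightarrow> real) \<Rightarrow> ennreal" where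
  "besov_seminorm M p q \<alpha> f =
     (SUP t\<in>{0<..}. ennreal (t powr (- \<alpha>)) *
        ennreal_powr (\<integral>\<^sup>+y. (\<integral>\<^sup>+x. ennreal (\<bar>f x - f y\<bar> powr q) \<partial>p t y) \<partial>M) (1 / q))"

definition besov_space ::
  "'a measure \<Rightarrow> (real \<Rightarrow> 'a \<Rightarrow> 'a measure) \<Rightarrow> real \<Rightarrow> real \<Rightarrow> ('a \<Rightarrow> real) set" where
  "besov_space M p q \<alpha> = {f \<in> Lp M q. besov_seminorm M p q \<alpha> f < \<infinity>}"

end

theory Submission
  imports Defs
begin

text \<open>
  Put \<open>B\<^sub>t(f, g) = \<langle>f - P t f, g\<rangle>\<close>. Since the kernels are symmetric probability kernels,
  \<open>\<integral>\<integral> |f x - f y|\<^sup>2 p\<^sub>t(y, dx) d\<mu>(y) = 2 B\<^sub>t(f, f)\<close>, so the claim is that \<open>B\<^sub>t(f, f) \<le> t C\<close> for all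
  \<open>t > 0\<close> if and only if \<open>f \<in> F\<close> and \<open>E f f \<le> C\<close>.

  No spectral theorem is needed. Let \<open>u\<^sub>n\<close> minimise \<open>E u u + (n + 1) \<parallel>f - u\<parallel>\<^sup>2\<close> over \<open>F\<close>, with minimum
  \<open>a\<^sub>n\<close>. Then \<open>u\<^sub>n\<close> is in the domain of the generator, and on that domain \<open>B\<^sub>t(u, u) \<le> t E u u\<close>, because
  \<open>B\<^sub>t(u, u) / t\<close> increases when \<open>t\<close> is halved and tends to \<open>E u u\<close>. If \<open>B\<^sub>t(f, f) \<le> t C\<close>, then
  Cauchy--Schwarz for \<open>B\<^sub>t\<close> gives \<open>a\<^sub>n\<^sup>2 = lim (B\<^sub>t(u\<^sub>n, f) / t)\<^sup>2 \<le> E u\<^sub>n u\<^sub>n C \<le> a\<^sub>n C\<close>. The \<open>a\<^sub>n\<close> are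
  increasing, and now bounded by \<open>C\<close>, and they control the energy of \<open>u\<^sub>m - u\<^sub>n\<close>, so closedness of the
  form puts \<open>f = lim u\<^sub>n\<close> into \<open>F\<close>. The converse follows by letting \<open>u\<^sub>n \<rightarrow> f\<close> in
  \<open>B\<^sub>t(u\<^sub>n, f)\<^sup>2 \<le> t E f f B\<^sub>t(f, f)\<close>.
\<close>

section \<open>Nonnegative symmetric forms\<close>

lemma le_if_power2_le_mult:
  fixes a b C :: real
  assumes "a\<^sup>2 \<le> b * C" "b \<le> a" "0 \<le> C" "0 \<le> a"
  shows "a \<le> C"
proof (cases "a = 0")
  case False
  have "a * a \<le> a * C"
    using assms mult_right_mono[OF assms(2,3)] by (simp add: power2_eq_square)
  thus ?thesis using False assms(4) by simp
qed (use assms in simp)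

text \<open>A common setting for four forms: \<open>E\<close> on \<open>F\<close>,
  \<open>L2_inner\<close> and \<open>semigroup_defect\<close> on \<open>Lp M 2\<close>, and
  \<open>E\<close> plus a multiple of \<open>L2_inner\<close> on \<open>F\<close>. Only
  semi-definiteness is asked, because functions equal almost everywhere are not identified.\<close>

locale nonneg_symmetric_form =
  fixes V :: "('a \<Rightarrow> real) set" and B :: "('a \<Rightarrow> real) \<Rightarrow> ('a \<Rightarrow> real) \<Rightarrow> real"
  assumes zero_mem: "(\<lambda>x. 0) \<in> V"
    and add_mem: "f \<in> V \<Longrightarrow> g \<in> V \<Longrightarrow> (\<lambda>x. f x + g x) \<in> V"
    and scale_mem: "f \<in> V \<Longrightarrow> (\<lambda>x. c * f x) \<in> V"
    and add_left: "f \<in> V \<Longrightarrow> g \<in> V \<Longrightarrow> h \<in> V \<Longrightarrow> B (\<lambda>x. f x + g x) h = B f h + B g h"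
    and scale_left: "f \<in> V \<Longrightarrow> h \<in> V \<Longrightarrow> B (\<lambda>x. c * f x) h = c * B f h"
    and sym: "f \<in> V \<Longrightarrow> g \<in> V \<Longrightarrow> B f g = B g f"
    and nonneg: "f \<in> V \<Longrightarrow> 0 \<le> B f f"
begin

lemma add_right: "f \<in> V \<Longrightarrow> g \<in> V \<Longrightarrow> h \<in> V \<Longrightarrow> B h (\<lambda>x. f x + g x) = B h f + B h g"
  by (simp add: add_left add_mem sym[of h])

lemma scale_right: "f \<in> V \<Longrightarrow> h \<in> V \<Longrightarrow> B h (\<lambda>x. c * f x) = c * B h f"
  by (simp add: scale_left scale_mem sym[of h])

lemma diff_mem: "f \<in> V \<Longrightarrow> g \<in> V \<Longrightarrow> (\<lambda>x. f x - g x) \<in> V"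
  using add_mem[of f "\<lambda>x. (-1) * g x"] scale_mem[of g "-1"] by simp

lemma diff_left: "f \<in> V \<Longrightarrow> g \<in> V \<Longrightarrow> h \<in> V \<Longrightarrow> B (\<lambda>x. f x - g x) h = B f h - B g h"
  using add_left[of f "\<lambda>x. (-1) * g x" h] scale_left[of g h "-1"] scale_mem[of g "-1"] by simp

lemma diff_right: "f \<in> V \<Longrightarrow> g \<in> V \<Longrightarrow> h \<in> V \<Longrightarrow> B h (\<lambda>x. f x - g x) = B h f - B h g"
  by (simp add: diff_left diff_mem sym[of h])

lemma diff_self:
  assumes "f \<in> V" "g \<in> V"
  shows "B (\<lambda>x. f x - g x) (\<lambda>x. f x - g x) = B f f - 2 * B f g + B g g"
  using assms sym[of f g] by (simp add: diff_left diff_right diff_mem)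

lemma diff_commute:
  assumes "f \<in> V" "g \<in> V"
  shows "B (\<lambda>x. f x - g x) (\<lambda>x. f x - g x) = B (\<lambda>x. g x - f x) (\<lambda>x. g x - f x)"
  using assms sym[of f g] by (simp add: diff_self)

lemma Cauchy_Schwarz:
  assumes f: "f \<in> V" and g: "g \<in> V"
  shows "(B f g)\<^sup>2 \<le> B f f * B g g"
proof -
  have q: "0 \<le> B f f + 2 * s * B f g + s\<^sup>2 * B g g" for s
    using nonneg[OF add_mem[OF f scale_mem[OF g]], of s] f g sym[OF f g]
    by (simp add: add_left add_right scale_left scale_right add_mem scale_mem
        power2_eq_square algebra_simps)
  show ?thesis
  proof (cases "B g g = 0")
    case True
    have "B f g = 0"
    proof (rule ccontr)
      assume "B f g \<noteq> 0"
      \<comment> \<open>With \<open>B g g = 0\<close> the quadratic \<open>q\<close> is affine in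
        \<open>s\<close>; at this \<open>s\<close> its value is -1.\<close>
      thus False using q[of "- (B f f + 1) / (2 * B f g)"] True by (simp add: field_simps)
    qed
    thus ?thesis using nonneg f g by simp
  next
    case False
    hence "B g g > 0" using nonneg[OF g] by simp
    thus ?thesis using q[of "- B f g / B g g"]
      by (simp add: field_simps power2_eq_square)
  qed
qed

lemma abs_le: "f \<in> V \<Longrightarrow> g \<in> V \<Longrightarrow> \<bar>B f g\<bar> \<le> sqrt (B f f) * sqrt (B g g)"
  using real_sqrt_le_mono[OF Cauchy_Schwarz[of f g]] by (simp add: real_sqrt_mult)

lemma tendsto_left:
  assumes u: "\<And>n. u n \<in> V" and v: "v \<in> V" and w: "w \<in> V"
    and lim: "((\<lambda>n. B (\<lambda>x. u n x - v x) (\<lambda>x. u n x - v x)) \<longlongrightarrow> 0) G"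
  shows "((\<lambda>n. B (u n) w) \<longlongrightarrow> B v w) G"
proof -
  have "((\<lambda>n. B (\<lambda>x. u n x - v x) w) \<longlongrightarrow> 0) G"
  proof (rule Lim_null_comparison)
    show "\<forall>\<^sub>F n in G. norm (B (\<lambda>x. u n x - v x) w)
        \<le> sqrt (B (\<lambda>x. u n x - v x) (\<lambda>x. u n x - v x)) * sqrt (B w w)"
      using abs_le[OF diff_mem[OF u v] w] by simp
    show "((\<lambda>n. sqrt (B (\<lambda>x. u n x - v x) (\<lambda>x. u n x - v x)) * sqrt (B w w)) \<longlongrightarrow> 0) G"
      using tendsto_mult[OF tendsto_real_sqrt[OF lim] tendsto_const[of "sqrt (B w w)"]] by simp
  qed
  thus ?thesis using u v w by (simp add: diff_left LIM_zero_iff)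
qed

text \<open>Direct method: the bound on \<open>\<phi>\<close> makes
  \<open>Q u = B u u - 2 * \<phi> u\<close> bounded below by \<open>- C\<close>, a minimising
  sequence is Cauchy, and the first variation at its limit is the claim. Without definiteness the
  representing vector is unique only up to null vectors.\<close>

lemma Riesz_representation:
  assumes complete: "\<And>u :: nat \<Rightarrow> 'a \<Rightarrow> real. range u \<subseteq> V \<Longrightarrow>
      (\<And>\<epsilon>. \<epsilon> > 0 \<Longrightarrow> \<exists>N. \<forall>m\<ge>N. \<forall>n\<ge>N. B (\<lambda>x. u m x - u n x) (\<lambda>x. u m x - u n x) < \<epsilon>) \<Longrightarrow>
      \<exists>v\<in>V. (\<lambda>n. B (\<lambda>x. u n x - v x) (\<lambda>x. u n x - v x)) \<longlonglongrightarrow> 0"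
    and phi_add: "\<And>f g. f \<in> V \<Longrightarrow> g \<in> V \<Longrightarrow> \<phi> (\<lambda>x. f x + g x) = \<phi> f + \<phi> g"
    and phi_scale: "\<And>f c. f \<in> V \<Longrightarrow> \<phi> (\<lambda>x. c * f x) = c * \<phi> f"
    and phi_bound: "\<And>f. f \<in> V \<Longrightarrow> (\<phi> f)\<^sup>2 \<le> C * B f f"
    and C: "0 \<le> C"
  shows "\<exists>u\<in>V. \<forall>w\<in>V. B u w = \<phi> w"
proof -
  define Q where "Q u = B u u - 2 * \<phi> u" for u
  define m where "m = (INF u\<in>V. Q u)"
  have "- C \<le> Q f" if f: "f \<in> V" for f
  proof -
    have "(2 * \<phi> f)\<^sup>2 \<le> 4 * (C * B f f)"
      using phi_bound[OF f] by (simp add: power2_eq_square)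
    also have "\<dots> \<le> (C + B f f)\<^sup>2"
      using zero_le_power2[of "C - B f f"] by (simp add: power2_eq_square algebra_simps)
    finally have "2 * \<phi> f \<le> C + B f f"
      by (rule power2_le_imp_le) (use C nonneg[OF f] in simp)
    thus ?thesis by (simp add: Q_def)
  qed
  hence bdd: "bdd_below (Q ` V)" by (rule bdd_belowI2)
  have Q_scale: "Q (\<lambda>x. c * f x) = c\<^sup>2 * B f f - 2 * c * \<phi> f" if "f \<in> V" for c f
    using that by (simp add: Q_def scale_left scale_right scale_mem phi_scale power2_eq_square)
  have Q_add: "Q (\<lambda>x. f x + g x) = Q f + Q g + 2 * B f g" if "f \<in> V" "g \<in> V" for f g
    using that sym[OF that] by (simp add: Q_def add_left add_right add_mem phi_add)
  have m_le: "m \<le> Q f" if "f \<in> V" for f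
    unfolding m_def using bdd that by (rule cINF_lower)
  have "\<exists>u\<in>V. Q u < m + inverse (real (Suc n))" for n
    using cINF_less_iff[OF _ bdd, of "m + inverse (real (Suc n))"] zero_mem
    unfolding m_def[symmetric] by auto
  then obtain u where u: "\<And>n. u n \<in> V" and Qu: "\<And>n. Q (u n) < m + inverse (real (Suc n))"
    by metis
  \<comment> \<open>The left side equals 2 Q(f) + 2 Q(g) - 4 Q((f + g)/2), and the midpoint value is
    at least \<open>m\<close>.\<close>
  have parallelogram: "B (\<lambda>x. f x - g x) (\<lambda>x. f x - g x) \<le> 2 * (Q f - m) + 2 * (Q g - m)"
    if f: "f \<in> V" and g: "g \<in> V" for f g
    using m_le[OF scale_mem[OF add_mem[OF f g]], of "1/2"] Q_add[OF f g] f g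
    unfolding Q_scale[OF add_mem[OF f g]] by (simp add: Q_def diff_self phi_add power2_eq_square field_simps)
  have "\<exists>v\<in>V. (\<lambda>n. B (\<lambda>x. u n x - v x) (\<lambda>x. u n x - v x)) \<longlonglongrightarrow> 0"
  proof (rule complete)
    fix \<epsilon> :: real assume "\<epsilon> > 0"
    \<comment> \<open>Each of the two excesses over \<open>m\<close> enters the parallelogram bound
      with factor 2, hence a quarter of \<open>\<epsilon>\<close>.\<close>
    then obtain N where N: "inverse (real (Suc N)) < \<epsilon> / 4"
      using reals_Archimedean[of "\<epsilon> / 4"] by auto
    have "B (\<lambda>x. u k x - u n x) (\<lambda>x. u k x - u n x) < \<epsilon>" if "k \<ge> N" "n \<ge> N" for k n
    proof -
      define r :: "nat \<Rightarrow> real" where "r i = inverse (real (Suc i))" for i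
      have "r k \<le> r N" "r n \<le> r N"
        using that by (simp_all add: r_def le_imp_inverse_le)
      hence "2 * (Q (u k) - m) + 2 * (Q (u n) - m) < \<epsilon>"
        using Qu[of k] Qu[of n] N unfolding r_def[symmetric] by argo
      thus ?thesis using parallelogram[OF u u, of k n] by (rule le_less_trans[rotated])
    qed
    thus "\<exists>N. \<forall>k\<ge>N. \<forall>n\<ge>N. B (\<lambda>x. u k x - u n x) (\<lambda>x. u k x - u n x) < \<epsilon>" by blast
  qed (use u in blast)
  then obtain v where v: "v \<in> V"
    and lim: "(\<lambda>n. B (\<lambda>x. u n x - v x) (\<lambda>x. u n x - v x)) \<longlonglongrightarrow> 0" by blast
  have "B v w = \<phi> w" if w: "w \<in> V" for w
  proof -
    define c where "c = B v w - \<phi> w"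
    \<comment> \<open>Compare \<open>Q\<close> at \<open>u n + s w\<close> with the infimum
      \<open>m\<close>; the near-minimality error of \<open>u n\<close> vanishes in the
      limit.\<close>
    have quadratic: "0 \<le> 2 * s * c + s\<^sup>2 * B w w" for s
    proof -
      have "0 \<le> 2 * s * (B (u n) w - \<phi> w) + s\<^sup>2 * B w w + inverse (real (Suc n))" for n
        using m_le[OF add_mem[OF u scale_mem[OF w]], of n s] Qu[of n]
        unfolding Q_add[OF u scale_mem[OF w]] Q_scale[OF w] scale_right[OF w u]
        by (simp add: right_diff_distrib)
      moreover have "(\<lambda>n. 2 * s * (B (u n) w - \<phi> w) + s\<^sup>2 * B w w + inverse (real (Suc n)))
          \<longlonglongrightarrow> 2 * s * c + s\<^sup>2 * B w w + 0"
        unfolding c_def by (intro tendsto_intros tendsto_left[OF u v w lim] LIMSEQ_inverse_real_of_nat)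
      ultimately show ?thesis using LIMSEQ_le_const[of _ "2 * s * c + s\<^sup>2 * B w w + 0" 0] by simp
    qed
    \<comment> \<open>The linear coefficient must vanish: s = -c refutes c different from 0 when the
      quadratic term is absent, and otherwise the vertex s = -c / B w w does.\<close>
    have "c = 0"
    proof (cases "B w w = 0")
      case True
      have "0 \<le> 2 * (- c) * c" using quadratic[of "- c"] True by simp
      thus ?thesis by (auto simp: mult_le_0_iff)
    next
      case False
      hence pos: "B w w > 0" using nonneg[OF w] by simp
      have "2 * (- c / B w w) * c + (- c / B w w)\<^sup>2 * B w w = - (c\<^sup>2 / B w w)"
        using False by (simp add: field_simps power2_eq_square)
      hence "c\<^sup>2 / B w w \<le> 0" using quadratic[of "- c / B w w"] by linarith
      thus ?thesis using pos by (simp add: divide_le_0_iff)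
    qed
    thus ?thesis by (simp add: c_def)
  qed
  thus ?thesis using v by blast
qed

end

section \<open>Resolvents of a closed form\<close>

lemma Lp2_iff: "f \<in> Lp M 2 \<longleftrightarrow> f \<in> borel_measurable M \<and> integrable M (\<lambda>x. f x * f x)"
  by (simp add: Lp_def power2_eq_square)

lemma Lp2_measurable: "f \<in> Lp M 2 \<Longrightarrow> f \<in> borel_measurable M"
  by (simp add: Lp2_iff)

lemma integrable_mult_Lp2:
  assumes f: "f \<in> Lp M 2" and g: "g \<in> Lp M 2"
  shows "integrable M (\<lambda>x. f x * g x)"
proof (rule Bochner_Integration.integrable_bound)
  show "integrable M (\<lambda>x. f x * f x + g x * g x)"
    using f g by (simp add: Lp2_iff)
  show "(\<lambda>x. f x * g x) \<in> borel_measurable M"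
    using f g by (auto simp: Lp2_iff)
  have "\<bar>f x * g x\<bar> \<le> f x * f x + g x * g x" for x
  proof -
    have "0 \<le> (\<bar>f x\<bar> - \<bar>g x\<bar>)\<^sup>2" by simp
    hence "2 * \<bar>f x * g x\<bar> \<le> f x * f x + g x * g x"
      by (simp add: power2_eq_square abs_mult algebra_simps)
    moreover have "0 \<le> \<bar>f x * g x\<bar>" by simp
    ultimately show ?thesis by linarith
  qed
  thus "AE x in M. norm (f x * g x) \<le> norm (f x * f x + g x * g x)"
    by (simp add: order_trans[OF _ abs_ge_self])
qed

interpretation L2: nonneg_symmetric_form "Lp M 2" "L2_inner M" for M
proof
  fix f g h :: "'a \<Rightarrow> real" and c :: real
  show "(\<lambda>x. 0) \<in> Lp M 2" by (simp add: Lp2_iff)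
  show "(\<lambda>x. f x + g x) \<in> Lp M 2" if "f \<in> Lp M 2" "g \<in> Lp M 2"
  proof -
    have "integrable M (\<lambda>x. f x * f x + 2 * (f x * g x) + g x * g x)"
      using that integrable_mult_Lp2[OF that] by (simp add: Lp2_iff)
    moreover have "(\<lambda>x. f x * f x + 2 * (f x * g x) + g x * g x) = (\<lambda>x. (f x + g x) * (f x + g x))"
      by (simp add: algebra_simps)
    ultimately show ?thesis using that by (auto simp: Lp2_iff)
  qed
  show "(\<lambda>x. c * f x) \<in> Lp M 2" if "f \<in> Lp M 2"
  proof -
    have "integrable M (\<lambda>x. c * c * (f x * f x))" using that by (simp add: Lp2_iff)
    thus ?thesis using that by (auto simp: Lp2_iff mult_ac)
  qed
  show "L2_inner M (\<lambda>x. f x + g x) h = L2_inner M f h + L2_inner M g h"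
    if "f \<in> Lp M 2" "g \<in> Lp M 2" "h \<in> Lp M 2"
    using that by (simp add: L2_inner_def distrib_right integrable_mult_Lp2)
  show "L2_inner M (\<lambda>x. c * f x) h = c * L2_inner M f h"
    by (simp add: L2_inner_def mult.assoc)
  show "L2_inner M f g = L2_inner M g f" by (simp add: L2_inner_def mult.commute)
  show "0 \<le> L2_inner M f f" by (simp add: L2_inner_def)
qed

lemma L2_inner_cong_AE:
  assumes "f \<in> Lp M 2" "f' \<in> Lp M 2" "g \<in> Lp M 2" "AE x in M. f x = f' x"
  shows "L2_inner M f g = L2_inner M f' g"
  unfolding L2_inner_def using assms by (intro integral_cong_AE) (auto simp: Lp2_iff)

text \<open>Stands in for definiteness, which \<open>L2_inner\<close> has only up to null
  sets.\<close>

lemma AE_eq_if_L2_inner_diff_eq_0: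
  assumes f: "f \<in> Lp M 2" and g: "g \<in> Lp M 2"
    and eq: "L2_inner M (\<lambda>x. f x - g x) (\<lambda>x. f x - g x) = 0"
  shows "AE x in M. f x = g x"
  using eq integral_nonneg_eq_0_iff_AE[of M "\<lambda>x. (f x - g x) * (f x - g x)"]
    integrable_mult_Lp2[OF L2.diff_mem[OF f g] L2.diff_mem[OF f g]]
  by (auto simp: L2_inner_def)

lemma symmetric_form_interp: "symmetric_form M E F \<Longrightarrow> nonneg_symmetric_form F E"
  unfolding symmetric_form_def nonneg_symmetric_form_def by blast

lemma symmetric_form_subset: "symmetric_form M E F \<Longrightarrow> f \<in> F \<Longrightarrow> f \<in> Lp M 2"
  unfolding symmetric_form_def by blast

text \<open>With L the operator of the form, u = l (l - L)^(-1) f. The equation says that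
  \<open>E + l * L2_inner\<close> represents the functional \<open>l * L2_inner M f\<close>, so
  Riesz applies; completeness is closedness of the form.\<close>

lemma form_resolvent_exists:
  assumes sf: "symmetric_form M E F" and closed: "closed_form M E F"
    and f: "f \<in> Lp M 2" and l: "0 < l"
  shows "\<exists>u\<in>F. \<forall>v\<in>F. E u v = l * L2_inner M (\<lambda>x. f x - u x) v"
proof -
  interpret E: nonneg_symmetric_form F E using sf by (rule symmetric_form_interp)
  note F = symmetric_form_subset[OF sf]
  define B where "B g h = E g h + l * L2_inner M g h" for g h
  \<comment> \<open>For every l > 0 the two quadratic forms are equivalent, so Cauchy sequences and
    limits can be carried over in both directions.\<close>
  have energy_le: "form_energy M E w \<le> (1 + 1 / l) * B w w"
    and le_energy: "B w w \<le> (1 + l) * form_energy M E w" if "w \<in> F" for w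
    using E.nonneg[OF that] L2.nonneg[OF F[OF that]] l
    by (simp_all add: form_energy_def B_def field_simps)
  interpret B: nonneg_symmetric_form F B
    by standard (use l in \<open>simp_all add: B_def E.zero_mem E.add_mem E.scale_mem E.add_left E.scale_left
        E.sym E.nonneg F L2.add_left L2.scale_left L2.sym L2.nonneg algebra_simps\<close>)
  have "\<exists>u\<in>F. \<forall>w\<in>F. B u w = l * L2_inner M f w"
  proof (rule B.Riesz_representation)
    fix u :: "nat \<Rightarrow> 'a \<Rightarrow> real"
    assume u: "range u \<subseteq> F"
      and cauchy: "\<And>\<epsilon>. \<epsilon> > 0 \<Longrightarrow>
        \<exists>N. \<forall>m\<ge>N. \<forall>n\<ge>N. B (\<lambda>x. u m x - u n x) (\<lambda>x. u m x - u n x) < \<epsilon>"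
    have uF: "u n \<in> F" for n using u by blast
    have "\<exists>N. \<forall>m\<ge>N. \<forall>n\<ge>N. form_energy M E (\<lambda>x. u m x - u n x) < \<epsilon>" if "\<epsilon> > 0" for \<epsilon>
    proof -
      have pos: "0 < 1 + 1 / l" using l by (simp add: add_pos_pos)
      then obtain N where N: "\<forall>m\<ge>N. \<forall>n\<ge>N. B (\<lambda>x. u m x - u n x) (\<lambda>x. u m x - u n x) < \<epsilon> / (1 + 1 / l)"
        using cauchy[of "\<epsilon> / (1 + 1 / l)"] \<open>\<epsilon> > 0\<close> by auto
      have "form_energy M E (\<lambda>x. u m x - u n x) < \<epsilon>" if "m \<ge> N" "n \<ge> N" for m n
      proof -
        have "(1 + 1 / l) * B (\<lambda>x. u m x - u n x) (\<lambda>x. u m x - u n x) < \<epsilon>"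
          using N that pos by (simp add: pos_less_divide_eq mult.commute)
        thus ?thesis using energy_le[OF E.diff_mem[OF uF uF], of m n] by simp
      qed
      thus ?thesis by blast
    qed
    then obtain v where v: "v \<in> F" and lim: "(\<lambda>n. form_energy M E (\<lambda>x. u n x - v x)) \<longlonglongrightarrow> 0"
      using closed u unfolding closed_form_def by blast
    have "(\<lambda>n. B (\<lambda>x. u n x - v x) (\<lambda>x. u n x - v x)) \<longlonglongrightarrow> 0"
    proof (rule tendsto_sandwich[OF _ _ tendsto_const])
      show "(\<lambda>n. (1 + l) * form_energy M E (\<lambda>x. u n x - v x)) \<longlonglongrightarrow> 0"
        using tendsto_mult[OF tendsto_const[of "1 + l"] lim] by simp
    qed (simp_all add: B.nonneg le_energy E.diff_mem uF v)
    thus "\<exists>v\<in>F. (\<lambda>n. B (\<lambda>x. u n x - v x) (\<lambda>x. u n x - v x)) \<longlonglongrightarrow> 0" using v by blast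
  next
    fix w assume w: "w \<in> F"
    have "(l * L2_inner M f w)\<^sup>2 = l * l * (L2_inner M f w)\<^sup>2" by (simp add: power2_eq_square)
    also have "\<dots> \<le> l * l * (L2_inner M f f * L2_inner M w w)"
      using l L2.Cauchy_Schwarz[OF f F[OF w]] by (intro mult_left_mono) auto
    also have "\<dots> = l * L2_inner M f f * (l * L2_inner M w w)" by simp
    also have "\<dots> \<le> l * L2_inner M f f * B w w"
      using l E.nonneg[OF w] L2.nonneg[OF f] by (intro mult_left_mono) (auto simp: B_def)
    finally show "(l * L2_inner M f w)\<^sup>2 \<le> l * L2_inner M f f * B w w" .
  qed (use l f F in \<open>simp_all add: L2.add_right L2.scale_right L2.nonneg algebra_simps\<close>)
  then obtain u where u: "u \<in> F" "\<forall>w\<in>F. B u w = l * L2_inner M f w" by blast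
  hence "\<forall>w\<in>F. E u w = l * L2_inner M (\<lambda>x. f x - u x) w"
    by (auto simp: B_def L2.diff_left f F algebra_simps)
  thus ?thesis using u by blast
qed

text \<open>\<open>u n\<close> is the resolvent approximation of \<open>f\<close> with parameter n +
  1, which is never 0. Here \<open>f\<close> is only in L2; whether it lies in \<open>F\<close> is
  what the approximations decide.\<close>

locale form_resolvents =
  fixes M :: "'a measure" and E F and f :: "'a \<Rightarrow> real" and u :: "nat \<Rightarrow> 'a \<Rightarrow> real"
  assumes sf: "symmetric_form M E F" and closed: "closed_form M E F"
    and f_L2: "f \<in> Lp M 2" and u_mem: "u n \<in> F"
    and u_eq: "v \<in> F \<Longrightarrow> E (u n) v = real (Suc n) * L2_inner M (\<lambda>x. f x - u n x) v"
begin

sublocale E: nonneg_symmetric_form F E using sf by (rule symmetric_form_interp)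

lemmas F_subset = symmetric_form_subset[OF sf]

definition approx_energy :: "nat \<Rightarrow> real" where
  "approx_energy n =
     E (u n) (u n) + real (Suc n) * L2_inner M (\<lambda>x. f x - u n x) (\<lambda>x. f x - u n x)"

text \<open>Testing the equation of \<open>u n\<close> with \<open>u n\<close> itself merges the two
  summands. The result is a pairing with \<open>f\<close>, the expression that the semigroup
  produces as t tends to 0.\<close>

lemma approx_energy_eq: "approx_energy n = real (Suc n) * L2_inner M (\<lambda>x. f x - u n x) f"
  using F_subset[OF u_mem] f_L2
  by (simp add: approx_energy_def u_eq u_mem L2.diff_right L2.diff_mem algebra_simps)

lemma energy_le_approx_energy: "E (u n) (u n) \<le> approx_energy n"
  using L2.nonneg[OF L2.diff_mem[OF f_L2 F_subset[OF u_mem]]] by (simp add: approx_energy_def)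

lemma dist_le_approx_energy:
  "real (Suc n) * L2_inner M (\<lambda>x. f x - u n x) (\<lambda>x. f x - u n x) \<le> approx_energy n"
  using E.nonneg[OF u_mem] by (simp add: approx_energy_def)

text \<open>\<open>u n\<close> minimises \<open>E g g + (n + 1) \<parallel>f - g\<parallel>\<^sup>2\<close> over \<open>F\<close>, and \<open>approx_energy n\<close> is the minimum.\<close>

lemma minimiser_identity:
  assumes g: "g \<in> F"
  shows "E g g + real (Suc n) * L2_inner M (\<lambda>x. f x - g x) (\<lambda>x. f x - g x) =
    approx_energy n + E (\<lambda>x. g x - u n x) (\<lambda>x. g x - u n x) +
    real (Suc n) * L2_inner M (\<lambda>x. g x - u n x) (\<lambda>x. g x - u n x)"
proof -
  define l where "l = real (Suc n)"
  note mem = f_L2 F_subset[OF g] F_subset[OF u_mem]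
  \<comment> \<open>Testing the resolvent equation with \<open>g\<close> and with \<open>u n\<close>
    turns all terms of \<open>E\<close> that involve \<open>u n\<close> into inner products; what
    remains is expansion of squares.\<close>
  have "E g (u n) = l * (L2_inner M f g - L2_inner M (u n) g)"
    "E (u n) (u n) = l * (L2_inner M f (u n) - L2_inner M (u n) (u n))"
    using u_eq[OF g, of n] u_eq[OF u_mem, of n n] mem E.sym[OF g u_mem, of n]
    by (simp_all add: l_def L2.diff_left)
  thus ?thesis
    using mem L2.sym[OF mem(2,3), of n]
    unfolding approx_energy_def l_def[symmetric]
    by (simp add: E.diff_self[OF g u_mem] L2.diff_self algebra_simps)
qed

text \<open>If \<open>f\<close> is in \<open>F\<close>, it is itself a competitor, at distance
  0.\<close>

lemma approx_energy_le:
  assumes f: "f \<in> F"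
  shows "approx_energy n \<le> E f f"
proof -
  have "L2_inner M (\<lambda>x. f x - f x) (\<lambda>x. f x - f x) = 0"
    by (simp add: L2_inner_def)
  moreover have "0 \<le> real (Suc n) * L2_inner M (\<lambda>x. f x - u n x) (\<lambda>x. f x - u n x)"
    by (simp add: L2.nonneg L2.diff_mem f_L2 F_subset u_mem del: of_nat_Suc)
  ultimately show ?thesis
    using minimiser_identity[OF f, of n] E.nonneg[OF E.diff_mem[OF f u_mem], of n] by simp
qed

lemma dist_tendsto_0:
  assumes C: "\<And>n. approx_energy n \<le> C"
  shows "(\<lambda>n. L2_inner M (\<lambda>x. f x - u n x) (\<lambda>x. f x - u n x)) \<longlonglongrightarrow> 0"
proof (rule tendsto_sandwich[OF _ _ tendsto_const])
  show "(\<lambda>n. C * inverse (real (Suc n))) \<longlonglongrightarrow> 0"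
    using tendsto_mult[OF tendsto_const[of C] LIMSEQ_inverse_real_of_nat] by simp
  have "L2_inner M (\<lambda>x. f x - u n x) (\<lambda>x. f x - u n x) \<le> C * inverse (real (Suc n))" for n
    using order_trans[OF dist_le_approx_energy C, of n]
    by (simp add: field_simps del: of_nat_Suc)
  thus "\<forall>\<^sub>F n in sequentially. L2_inner M (\<lambda>x. f x - u n x) (\<lambda>x. f x - u n x)
      \<le> C * inverse (real (Suc n))" by simp
qed (simp add: L2.nonneg L2.diff_mem f_L2 F_subset u_mem)

text \<open>Use \<open>u m\<close> as competitor in the problem with the smaller parameter n + 1:
  its value there is at most \<open>approx_energy m\<close>. The excess over the minimum dominates
  \<open>form_energy\<close> because n + 1 is at least 1.\<close>

lemma form_energy_diff_le:
  assumes "n \<le> m"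
  shows "form_energy M E (\<lambda>x. u m x - u n x) \<le> approx_energy m - approx_energy n"
proof -
  have nonneg: "0 \<le> L2_inner M (\<lambda>x. u m x - u n x) (\<lambda>x. u m x - u n x)"
    "0 \<le> L2_inner M (\<lambda>x. f x - u m x) (\<lambda>x. f x - u m x)"
    by (simp_all add: L2.nonneg L2.diff_mem f_L2 F_subset u_mem)
  have "L2_inner M (\<lambda>x. u m x - u n x) (\<lambda>x. u m x - u n x)
      \<le> real (Suc n) * L2_inner M (\<lambda>x. u m x - u n x) (\<lambda>x. u m x - u n x)"
    using mult_right_mono[OF _ nonneg(1), of 1 "real (Suc n)"] by simp
  moreover have "real (Suc n) * L2_inner M (\<lambda>x. f x - u m x) (\<lambda>x. f x - u m x)
      \<le> real (Suc m) * L2_inner M (\<lambda>x. f x - u m x) (\<lambda>x. f x - u m x)"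
    using assms nonneg(2) by (intro mult_right_mono) auto
  ultimately show ?thesis
    using minimiser_identity[OF u_mem, of m n] unfolding form_energy_def approx_energy_def[of m]
    by linarith
qed

text \<open>The energies increase and are bounded, hence are Cauchy, and so is \<open>u\<close> for
  \<open>form_energy\<close>. Closedness provides a limit in \<open>F\<close>, which must agree with
  the L2 limit \<open>f\<close>.\<close>

lemma mem_if_approx_energy_bounded:
  assumes C: "\<And>n. approx_energy n \<le> C"
  shows "f \<in> F" and "E f f \<le> C"
proof -
  have F_energy_nonneg: "0 \<le> form_energy M E w" if "w \<in> F" for w
    using E.nonneg[OF that] L2.nonneg[OF F_subset[OF that]] by (simp add: form_energy_def)
  have energy_commute: "form_energy M E (\<lambda>x. u m x - u n x) = form_energy M E (\<lambda>x. u n x - u m x)"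
    for m n
    using E.diff_commute[OF u_mem u_mem] L2.diff_commute[OF F_subset[OF u_mem] F_subset[OF u_mem]]
    by (simp add: form_energy_def)
  have "incseq approx_energy"
  proof (rule incseq_SucI)
    show "approx_energy n \<le> approx_energy (Suc n)" for n
      using form_energy_diff_le[of n "Suc n"] F_energy_nonneg[OF E.diff_mem[OF u_mem u_mem], of "Suc n" n]
      by simp
  qed
  then obtain L where "approx_energy \<longlonglongrightarrow> L"
    using incseq_convergent C by blast
  hence cauchy: "Cauchy approx_energy" by (rule LIMSEQ_imp_Cauchy)
  have "\<exists>N. \<forall>m\<ge>N. \<forall>n\<ge>N. form_energy M E (\<lambda>x. u m x - u n x) < \<epsilon>" if "\<epsilon> > 0" for \<epsilon>
  proof -
    obtain N where N: "\<And>m n. m \<ge> N \<Longrightarrow> n \<ge> N \<Longrightarrow> \<bar>approx_energy m - approx_energy n\<bar> < \<epsilon>"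
      using cauchy \<open>\<epsilon> > 0\<close> unfolding Cauchy_def dist_real_def by blast
    have "form_energy M E (\<lambda>x. u m x - u n x) < \<epsilon>" if "m \<ge> N" "n \<ge> N" for m n
      using N[OF that] form_energy_diff_le[of n m] form_energy_diff_le[of m n] energy_commute[of m n]
      by (cases "n \<le> m") auto
    thus ?thesis by blast
  qed
  moreover have "range u \<subseteq> F" using u_mem by blast
  ultimately obtain v where v: "v \<in> F"
    and lim: "(\<lambda>n. form_energy M E (\<lambda>x. u n x - v x)) \<longlonglongrightarrow> 0"
    using closed unfolding closed_form_def by blast
  note mem = f_L2 F_subset[OF v] F_subset[OF u_mem]
  have limE: "(\<lambda>n. E (\<lambda>x. u n x - v x) (\<lambda>x. u n x - v x)) \<longlonglongrightarrow> 0"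
    by (rule tendsto_sandwich[OF _ _ tendsto_const lim])
      (simp_all add: form_energy_def E.nonneg L2.nonneg E.diff_mem L2.diff_mem u_mem v mem)
  have limL2: "(\<lambda>n. L2_inner M (\<lambda>x. u n x - v x) (\<lambda>x. u n x - v x)) \<longlonglongrightarrow> 0"
    by (rule tendsto_sandwich[OF _ _ tendsto_const lim])
      (simp_all add: form_energy_def E.nonneg L2.nonneg E.diff_mem L2.diff_mem u_mem v mem)
  have limL2': "(\<lambda>n. L2_inner M (\<lambda>x. u n x - f x) (\<lambda>x. u n x - f x)) \<longlonglongrightarrow> 0"
    using dist_tendsto_0[OF C] L2.diff_commute[OF mem(3,1)] by simp
  have inner_eq: "L2_inner M v w = L2_inner M f w" if "w \<in> Lp M 2" for w
    using L2.tendsto_left[OF mem(3,2) that limL2] L2.tendsto_left[OF mem(3,1) that limL2']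
    by (rule LIMSEQ_unique)
  \<comment> \<open>Both are L2 limits of \<open>u\<close>, so they pair equally with every element,
    in particular with v - f. \<open>F\<close> and \<open>E\<close> do not distinguish functions
    equal almost everywhere.\<close>
  have "AE x in M. v x = f x"
    using mem inner_eq by (intro AE_eq_if_L2_inner_diff_eq_0) (simp_all add: L2.diff_left L2.diff_mem)
  hence fF: "f \<in> F" and Ef: "\<And>h. h \<in> F \<Longrightarrow> E v h = E f h"
    using sf v f_L2 unfolding symmetric_form_def by (auto simp: Lp2_iff)
  show "f \<in> F" by (rule fF)
  have "C \<ge> 0" using E.nonneg[OF u_mem] order_trans[OF energy_le_approx_energy C] by (rule order_trans)
  \<comment> \<open>Only the left argument moves, so \<open>tendsto_left\<close> suffices;
    Cauchy--Schwarz then bounds the limit by \<open>E f f * C\<close>, and one factor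
    \<open>E f f\<close> cancels.\<close>
  have "(\<lambda>n. (E (u n) f)\<^sup>2) \<longlonglongrightarrow> (E f f)\<^sup>2"
    using E.tendsto_left[OF u_mem v fF limE] Ef[OF fF] by (intro tendsto_power) simp
  moreover have "(E (u n) f)\<^sup>2 \<le> E f f * C" for n
  proof -
    have "(E (u n) f)\<^sup>2 \<le> E (u n) (u n) * E f f" by (rule E.Cauchy_Schwarz[OF u_mem fF])
    also have "\<dots> \<le> C * E f f"
      using order_trans[OF energy_le_approx_energy C] E.nonneg[OF fF] by (rule mult_right_mono)
    finally show ?thesis by (simp add: mult.commute)
  qed
  ultimately have "(E f f)\<^sup>2 \<le> E f f * C" using LIMSEQ_le_const2 by blast
  thus "E f f \<le> C"
    using le_if_power2_le_mult[of "E f f" "E f f" C] \<open>C \<ge> 0\<close> E.nonneg[OF fF] by simp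
qed

end

section \<open>The form as a limit of semigroup defects\<close>

text \<open>Divided by t, this is the usual approximating form of a Dirichlet form.\<close>

definition semigroup_defect ::
  "'a measure \<Rightarrow> (real \<Rightarrow> ('a \<Rightarrow> real) \<Rightarrow> 'a \<Rightarrow> real) \<Rightarrow> real
     \<Rightarrow> ('a \<Rightarrow> real) \<Rightarrow> ('a \<Rightarrow> real) \<Rightarrow> real" where
  "semigroup_defect M P t f g = L2_inner M f g - L2_inner M (P t f) g"

section \<open>Symmetric contraction semigroups and their defects\<close>

locale symmetric_semigroup =
  fixes M :: "'a measure" and P :: "real \<Rightarrow> ('a \<Rightarrow> real) \<Rightarrow> 'a \<Rightarrow> real"
  assumes semigroup: "symmetric_contraction_semigroup M P"
begin

lemmas semigroup_conjs = semigroup[unfolded symmetric_contraction_semigroup_def]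

lemma P_mem: "0 \<le> t \<Longrightarrow> f \<in> Lp M 2 \<Longrightarrow> P t f \<in> Lp M 2"
  using semigroup_conjs[THEN conjunct1] by simp

lemma P_contraction:
  assumes "0 \<le> t" "f \<in> Lp M 2"
  shows "L2_inner M (P t f) (P t f) \<le> L2_inner M f f"
  using semigroup_conjs[THEN conjunct1] assms by (simp add: L2_norm_def)

lemmas P_add = semigroup_conjs[THEN conjunct2, THEN conjunct2, THEN conjunct1, rule_format]

lemmas P_scale = semigroup_conjs[THEN conjunct2, THEN conjunct2, THEN conjunct2,
  THEN conjunct1, rule_format]

lemmas P_symmetric = semigroup_conjs[THEN conjunct2, THEN conjunct2, THEN conjunct2,
  THEN conjunct2, THEN conjunct1, rule_format]

lemmas P_semigroup = semigroup_conjs[THEN conjunct2, THEN conjunct2, THEN conjunct2,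
  THEN conjunct2, THEN conjunct2, THEN conjunct2, THEN conjunct1, rule_format]

text \<open>Nonnegativity is Cauchy--Schwarz together with contractivity. \<open>P t\<close> is
  linear only almost everywhere, so linearity passes through
  \<open>L2_inner_cong_AE\<close>.\<close>

lemma semigroup_defect_form:
  assumes t: "0 \<le> t"
  shows "nonneg_symmetric_form (Lp M 2) (semigroup_defect M P t)"
proof
  fix f g h and c :: real
  assume f: "f \<in> Lp M 2"
  have sum: "(\<lambda>x. P t f x + P t g x) \<in> Lp M 2" if "g \<in> Lp M 2"
    using t f that by (simp add: P_mem L2.add_mem)
  show "(\<lambda>x. f x + g x) \<in> Lp M 2" if "g \<in> Lp M 2" using f that by (rule L2.add_mem)
  show "(\<lambda>x. c * f x) \<in> Lp M 2" using f by (rule L2.scale_mem)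
  show "semigroup_defect M P t (\<lambda>x. f x + g x) h = semigroup_defect M P t f h + semigroup_defect M P t g h"
    if g: "g \<in> Lp M 2" and h: "h \<in> Lp M 2"
    using L2_inner_cong_AE[OF P_mem[OF t L2.add_mem[OF f g]] sum[OF g] h P_add[OF t f g]] f g h t
    by (simp add: semigroup_defect_def L2.add_left P_mem)
  show "semigroup_defect M P t (\<lambda>x. c * f x) h = c * semigroup_defect M P t f h"
    if h: "h \<in> Lp M 2"
    using L2_inner_cong_AE[OF P_mem[OF t L2.scale_mem[OF f]] L2.scale_mem[OF P_mem[OF t f]] h P_scale[OF t f]] f h t
    by (simp add: semigroup_defect_def L2.scale_left P_mem right_diff_distrib)
  show "semigroup_defect M P t f g = semigroup_defect M P t g f" if g: "g \<in> Lp M 2"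
    using P_symmetric[OF t f g] L2.sym[OF f P_mem[OF t g]] L2.sym[OF f g]
    by (simp add: semigroup_defect_def)
  have "(L2_inner M (P t f) f)\<^sup>2 \<le> L2_inner M (P t f) (P t f) * L2_inner M f f"
    using P_mem[OF t f] f by (rule L2.Cauchy_Schwarz)
  also have "\<dots> \<le> L2_inner M f f * L2_inner M f f"
    using P_contraction[OF t f] L2.nonneg[OF f] by (rule mult_right_mono)
  finally have "(L2_inner M (P t f) f)\<^sup>2 \<le> (L2_inner M f f)\<^sup>2" by (simp add: power2_eq_square)
  hence "L2_inner M (P t f) f \<le> L2_inner M f f"
    using L2.nonneg[OF f] by (rule power2_le_imp_le)
  thus "0 \<le> semigroup_defect M P t f f" by (simp add: semigroup_defect_def)
qed (rule L2.zero_mem)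

text \<open>By the semigroup law and symmetry, the right side minus the left side is the squared
  norm of P_{t/2} f - f. This replaces a convexity argument on the spectrum.\<close>

lemma semigroup_defect_halve:
  assumes t: "0 \<le> t" and f: "f \<in> Lp M 2"
  shows "semigroup_defect M P t f f \<le> 2 * semigroup_defect M P (t / 2) f f"
proof -
  have t2: "0 \<le> t / 2" using t by simp
  note Pf = P_mem[OF t2 f]
  have "L2_inner M (P t f) f = L2_inner M (P (t / 2) (P (t / 2) f)) f"
    using P_semigroup[OF t2 t2 f] P_mem[OF t f] P_mem[OF t2 Pf] f
    by (intro L2_inner_cong_AE) auto
  also have "\<dots> = L2_inner M (P (t / 2) f) (P (t / 2) f)"
    using P_symmetric[OF t2 Pf f] by simp
  finally have "L2_inner M (\<lambda>x. P (t / 2) f x - f x) (\<lambda>x. P (t / 2) f x - f x) =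
      L2_inner M (P t f) f - 2 * L2_inner M (P (t / 2) f) f + L2_inner M f f"
    by (simp add: L2.diff_self[OF Pf f])
  thus ?thesis
    using L2.nonneg[OF L2.diff_mem[OF Pf f]] by (simp add: semigroup_defect_def)
qed

lemma semigroup_defect_le_halves:
  assumes t: "0 \<le> t" and f: "f \<in> Lp M 2"
  shows "semigroup_defect M P t f f \<le> 2 ^ n * semigroup_defect M P (t / 2 ^ n) f f"
proof (induction n)
  case (Suc n)
  note Suc
  also have "2 ^ n * semigroup_defect M P (t / 2 ^ n) f f
      \<le> 2 ^ n * (2 * semigroup_defect M P (t / 2 ^ n / 2) f f)"
    using semigroup_defect_halve[of "t / 2 ^ n" f] f t by (intro mult_left_mono) auto
  finally show ?case by (simp add: mult.commute mult.left_commute)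
qed simp

text \<open>The quotient is minus the pairing of the difference quotient (P_t f - f)/t with
  \<open>h\<close>. The difference quotient converges in norm, hence also when paired with
  \<open>h\<close>.\<close>

lemma semigroup_defect_generator:
  assumes fg: "(f, g) \<in> semigroup_generator M P" and h: "h \<in> Lp M 2"
  shows "((\<lambda>t. semigroup_defect M P t f h / t) \<longlongrightarrow> - L2_inner M g h) (at_right 0)"
proof -
  have f: "f \<in> Lp M 2" and g: "g \<in> Lp M 2"
    and lim: "((\<lambda>t. L2_norm M (\<lambda>x. (P t f x - f x) / t - g x)) \<longlongrightarrow> 0) (at_right 0)"
    using fg by (auto simp: semigroup_generator_def)
  have "((\<lambda>t. - semigroup_defect M P t f h / t - L2_inner M g h) \<longlongrightarrow> 0) (at_right 0)"
  proof (rule Lim_null_comparison)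
    show "((\<lambda>t. L2_norm M (\<lambda>x. (P t f x - f x) / t - g x) * L2_norm M h) \<longlongrightarrow> 0) (at_right 0)"
      using tendsto_mult[OF lim tendsto_const[of "L2_norm M h"]] by simp
    have "norm (- semigroup_defect M P t f h / t - L2_inner M g h)
        \<le> L2_norm M (\<lambda>x. (P t f x - f x) / t - g x) * L2_norm M h" if "t > 0" for t
    proof -
      have t: "0 \<le> t" using that by simp
      have d: "(\<lambda>x. P t f x - f x) \<in> Lp M 2" using f t by (simp add: P_mem L2.diff_mem)
      have q: "(\<lambda>x. (P t f x - f x) / t) \<in> Lp M 2"
        using L2.scale_mem[OF d, of "1 / t"] by simp
      have "L2_inner M (\<lambda>x. (P t f x - f x) / t) h = - semigroup_defect M P t f h / t"
        using L2.scale_left[OF d h, of "1 / t"] f h t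
        by (simp add: L2.diff_left P_mem semigroup_defect_def)
      thus ?thesis
        using L2.abs_le[OF L2.diff_mem[OF q g] h] q g h by (simp add: L2.diff_left L2_norm_def)
    qed
    thus "\<forall>\<^sub>F t in at_right 0. norm (- semigroup_defect M P t f h / t - L2_inner M g h)
        \<le> L2_norm M (\<lambda>x. (P t f x - f x) / t - g x) * L2_norm M h"
      by (auto simp: eventually_at_right_field intro: exI[of _ 1])
  qed
  from tendsto_minus[OF tendsto_add[OF this tendsto_const[of "L2_inner M g h"]]]
  show ?thesis by simp
qed

text \<open>Along t / 2^n the defect divided by time stays above its value at t, and its limit is
  known from the generator.\<close>

lemma semigroup_defect_le_generator:
  assumes fg: "(f, g) \<in> semigroup_generator M P" and t: "0 < t"
  shows "semigroup_defect M P t f f \<le> t * - L2_inner M g f"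
proof -
  have f: "f \<in> Lp M 2" using fg by (simp add: semigroup_generator_def)
  have "(\<lambda>n. t / 2 ^ n) \<longlonglongrightarrow> 0"
    using tendsto_mult[OF tendsto_const[of t] LIMSEQ_realpow_zero[of "1 / 2"]]
    by (simp add: power_divide)
  hence "filterlim (\<lambda>n. t / 2 ^ n) (at_right 0) sequentially"
    using t by (auto simp: filterlim_at)
  from filterlim_compose[OF semigroup_defect_generator[OF fg f] this]
  have "(\<lambda>n. semigroup_defect M P (t / 2 ^ n) f f / (t / 2 ^ n)) \<longlonglongrightarrow> - L2_inner M g f" .
  moreover have "semigroup_defect M P t f f / t \<le> semigroup_defect M P (t / 2 ^ n) f f / (t / 2 ^ n)" for n
    using semigroup_defect_le_halves[OF _ f, of t n] t by (simp add: field_simps)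
  ultimately have "semigroup_defect M P t f f / t \<le> - L2_inner M g f"
    using LIMSEQ_le_const by blast
  thus ?thesis using t by (simp add: field_simps)
qed

end

section \<open>Comparison of the defects with the form through resolvents\<close>

locale heat_resolvents = form_resolvents M E F f u + symmetric_semigroup M P
  for M :: "'a measure" and E F f u P +
  assumes generator: "semigroup_generator M P = form_generator M E F"
begin

lemma generator_u_inner:
  assumes v: "v \<in> Lp M 2"
  shows "- L2_inner M (\<lambda>x. real (Suc n) * (u n x - f x)) v =
    real (Suc n) * L2_inner M (\<lambda>x. f x - u n x) v"
proof -
  note un = F_subset[OF u_mem, of n]
  have "L2_inner M (\<lambda>x. real (Suc n) * (u n x - f x)) v = real (Suc n) * L2_inner M (\<lambda>x. u n x - f x) v"
    using L2.diff_mem[OF un f_L2] v by (rule L2.scale_left)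
  also have "L2_inner M (\<lambda>x. u n x - f x) v = - L2_inner M (\<lambda>x. f x - u n x) v"
    by (simp only: L2.diff_left[OF un f_L2 v] L2.diff_left[OF f_L2 un v])
  finally show ?thesis by simp
qed

text \<open>The resolvent equation puts \<open>u n\<close> into the domain of the form generator,
  with image (n + 1)(u n - f). The equality of the two generators, the link between form and
  semigroup, is invoked here.\<close>

lemma u_generator: "(u n, \<lambda>x. real (Suc n) * (u n x - f x)) \<in> semigroup_generator M P"
proof -
  have "(\<lambda>x. real (Suc n) * (u n x - f x)) \<in> Lp M 2"
    by (intro L2.scale_mem L2.diff_mem F_subset u_mem f_L2)
  moreover have "E (u n) v = - L2_inner M (\<lambda>x. real (Suc n) * (u n x - f x)) v" if "v \<in> F" for v
    by (simp only: generator_u_inner[OF F_subset[OF that]] u_eq[OF that])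
  ultimately show ?thesis
    unfolding generator form_generator_def using u_mem by blast
qed

lemma semigroup_defect_u_le:
  assumes t: "0 < t"
  shows "semigroup_defect M P t (u n) (u n) \<le> t * E (u n) (u n)"
proof -
  have "- L2_inner M (\<lambda>x. real (Suc n) * (u n x - f x)) (u n) = E (u n) (u n)"
    by (simp only: generator_u_inner[OF F_subset[OF u_mem]] u_eq[OF u_mem])
  thus ?thesis using semigroup_defect_le_generator[OF u_generator t, of n] by (simp only:)
qed

lemma approx_energy_le_if_defect_le:
  assumes C: "\<And>t. 0 < t \<Longrightarrow> semigroup_defect M P t f f \<le> t * C"
  shows "approx_energy n \<le> C"
proof (rule le_if_power2_le_mult)
  have "((\<lambda>t. semigroup_defect M P t (u n) f / t) \<longlongrightarrow>
      - L2_inner M (\<lambda>x. real (Suc n) * (u n x - f x)) f) (at_right 0)"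
    by (rule semigroup_defect_generator[OF u_generator f_L2])
  \<comment> \<open>The generator image of \<open>u n\<close> is paired with \<open>f\<close>
    instead of \<open>u n\<close>, which gives the whole \<open>approx_energy n\<close> and not just
    \<open>E (u n) (u n)\<close>.\<close>
  moreover have "- L2_inner M (\<lambda>x. real (Suc n) * (u n x - f x)) f = approx_energy n"
    by (simp only: generator_u_inner[OF f_L2] approx_energy_eq)
  ultimately have lim: "((\<lambda>t. (semigroup_defect M P t (u n) f / t)\<^sup>2) \<longlongrightarrow> (approx_energy n)\<^sup>2) (at_right 0)"
    by (simp add: tendsto_power)
  have bound: "(semigroup_defect M P t (u n) f / t)\<^sup>2 \<le> E (u n) (u n) * C" if t: "0 < t" for t
  proof -
    interpret D: nonneg_symmetric_form "Lp M 2" "semigroup_defect M P t"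
      by (rule semigroup_defect_form) (use t in simp)
    note un = F_subset[OF u_mem, of n]
    have "(semigroup_defect M P t (u n) f)\<^sup>2 \<le> semigroup_defect M P t (u n) (u n) * semigroup_defect M P t f f"
      by (rule D.Cauchy_Schwarz[OF un f_L2])
    also have "\<dots> \<le> (t * E (u n) (u n)) * (t * C)"
      using semigroup_defect_u_le[OF t] C[OF t] D.nonneg[OF f_L2] E.nonneg[OF u_mem] t
      by (intro mult_mono) auto
    finally show ?thesis using t by (simp add: power_divide divide_le_eq power2_eq_square mult_ac)
  qed
  show "(approx_energy n)\<^sup>2 \<le> E (u n) (u n) * C"
    using lim by (rule tendsto_upperbound)
      (use bound in \<open>auto simp: eventually_at_right_field intro: exI[of _ 1]\<close>)
  show "E (u n) (u n) \<le> approx_energy n" by (rule energy_le_approx_energy)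
  \<comment> \<open>The sign of \<open>C\<close> comes from the hypothesis at one positive time,
    here t = 1.\<close>
  have "0 \<le> semigroup_defect M P 1 f f"
    using nonneg_symmetric_form.nonneg[OF semigroup_defect_form f_L2] by simp
  thus "0 \<le> C" using C[of 1] by simp
  show "0 \<le> approx_energy n"
    using E.nonneg[OF u_mem] energy_le_approx_energy by (rule order_trans)
qed

text \<open>\<open>f\<close> need not be in the domain of the generator, but the \<open>u n\<close>
  are, and their energies are at most \<open>E f f\<close>. Keeping \<open>f\<close> in one slot,
  Cauchy--Schwarz and L2 convergence of \<open>u n\<close> suffice.\<close>

lemma semigroup_defect_le_form:
  assumes f: "f \<in> F" and t: "0 < t"
  shows "semigroup_defect M P t f f \<le> t * E f f"
proof -
  interpret D: nonneg_symmetric_form "Lp M 2" "semigroup_defect M P t"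
    by (rule semigroup_defect_form) (use t in simp)
  note un = F_subset[OF u_mem]
  have lim: "(\<lambda>n. L2_inner M (\<lambda>x. u n x - f x) (\<lambda>x. u n x - f x)) \<longlonglongrightarrow> 0"
    using dist_tendsto_0[OF approx_energy_le[OF f]] L2.diff_commute[OF un f_L2] by simp
  \<comment> \<open>Symmetry moves \<open>P t\<close> to the fixed argument, so that
    \<open>L2.tendsto_left\<close> applies to both terms.\<close>
  have "semigroup_defect M P t (u n) f = L2_inner M (u n) f - L2_inner M (u n) (P t f)" for n
    using t un f_L2 by (simp add: semigroup_defect_def P_symmetric)
  moreover have "semigroup_defect M P t f f = L2_inner M f f - L2_inner M f (P t f)"
    using t f_L2 by (simp add: semigroup_defect_def P_symmetric)
  moreover have "(\<lambda>n. L2_inner M (u n) f - L2_inner M (u n) (P t f))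
      \<longlonglongrightarrow> L2_inner M f f - L2_inner M f (P t f)"
    using t f_L2 by (intro tendsto_diff L2.tendsto_left[OF un f_L2 _ lim] P_mem) auto
  ultimately have "(\<lambda>n. (semigroup_defect M P t (u n) f)\<^sup>2) \<longlonglongrightarrow> (semigroup_defect M P t f f)\<^sup>2"
    by (simp add: tendsto_power)
  moreover have "(semigroup_defect M P t (u n) f)\<^sup>2 \<le> semigroup_defect M P t f f * (t * E f f)" for n
  proof -
    have "(semigroup_defect M P t (u n) f)\<^sup>2 \<le> semigroup_defect M P t (u n) (u n) * semigroup_defect M P t f f"
      by (rule D.Cauchy_Schwarz[OF un f_L2])
    also have "semigroup_defect M P t (u n) (u n) \<le> t * E f f"
    proof (rule order_trans[OF semigroup_defect_u_le[OF t]])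
      show "t * E (u n) (u n) \<le> t * E f f"
        using order_trans[OF energy_le_approx_energy approx_energy_le[OF f]] t
        by (intro mult_left_mono) auto
    qed
    finally show ?thesis using D.nonneg[OF f_L2] by (simp add: mult_right_mono mult.commute)
  qed
  ultimately have "(semigroup_defect M P t f f)\<^sup>2 \<le> semigroup_defect M P t f f * (t * E f f)"
    using LIMSEQ_le_const2 by blast
  thus ?thesis
    by (rule le_if_power2_le_mult) (use D.nonneg[OF f_L2] E.nonneg[OF f] t in auto)
qed

end

lemma heat_resolvents_exists:
  assumes "symmetric_form M E F" "closed_form M E F" "heat_semigroup M E F P" "f \<in> Lp M 2"
  obtains u where "heat_resolvents M E F f u P"
proof -
  have "\<exists>u. u \<in> F \<and> (\<forall>v\<in>F. E u v = real (Suc n) * L2_inner M (\<lambda>x. f x - u x) v)" for n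
    using form_resolvent_exists[OF assms(1,2,4), of "real (Suc n)"] by auto
  then obtain u where "\<And>n. u n \<in> F \<and> (\<forall>v\<in>F. E (u n) v = real (Suc n) * L2_inner M (\<lambda>x. f x - u n x) v)"
    by metis
  hence "heat_resolvents M E F f u P"
    using assms by unfold_locales (auto simp: heat_semigroup_def simp del: of_nat_Suc)
  thus thesis by (rule that)
qed

text \<open>As \<open>C\<close> is free, this encodes both membership in \<open>F\<close> and the
  value of \<open>E f f\<close> as the least admissible constant.\<close>

lemma semigroup_defect_le_iff_form_le:
  assumes "symmetric_form M E F" "closed_form M E F" "heat_semigroup M E F P" "f \<in> Lp M 2"
  shows "(\<forall>t>0. semigroup_defect M P t f f \<le> t * C) \<longleftrightarrow> f \<in> F \<and> E f f \<le> C"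
proof -
  obtain u where "heat_resolvents M E F f u P"
    using heat_resolvents_exists[OF assms] .
  then interpret heat_resolvents M E F f u P .
  show ?thesis
  proof
    assume "\<forall>t>0. semigroup_defect M P t f f \<le> t * C"
    hence "approx_energy n \<le> C" for n by (intro approx_energy_le_if_defect_le) auto
    thus "f \<in> F \<and> E f f \<le> C" using mem_if_approx_energy_bounded by blast
  next
    assume f: "f \<in> F \<and> E f f \<le> C"
    show "\<forall>t>0. semigroup_defect M P t f f \<le> t * C"
    proof (intro allI impI)
      fix t :: real assume t: "0 < t"
      have "t * E f f \<le> t * C" using f t by (intro mult_left_mono) auto
      with semigroup_defect_le_form[OF _ t] f show "semigroup_defect M P t f f \<le> t * C"
        by (blast intro: order_trans)
    qed
  qed
qed

section \<open>The heat kernel\<close>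

locale markov_semigroup = symmetric_semigroup M P + sigma_finite_measure M
  for M :: "'a measure" and P +
  fixes p :: "real \<Rightarrow> 'a \<Rightarrow> 'a measure"
  assumes kernel: "heat_kernel M P p"
begin

context
  fixes t :: real
  assumes t: "0 \<le> t"
begin

lemma kernel_prob: "p t \<in> M \<rightarrow>\<^sub>M prob_algebra M"
  using kernel t by (simp add: heat_kernel_def)

lemma prob_space_kernel: "x \<in> space M \<Longrightarrow> prob_space (p t x)"
  and sets_kernel: "x \<in> space M \<Longrightarrow> sets (p t x) = sets M"
  using measurable_space[OF kernel_prob] by (auto simp: space_prob_algebra)

lemma measurable_kernel_nn_integral [measurable]:
  "f \<in> borel_measurable M \<Longrightarrow> (\<lambda>x. \<integral>\<^sup>+y. f y \<partial>p t x) \<in> borel_measurable M"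
  using measurable_prob_algebraD[OF kernel_prob] nn_integral_measurable_subprob_algebra
  by (rule measurable_compose)

text \<open>The constant sequence \<open>f\<close> is admissible in
  \<open>extended_semigroup\<close>, so on nonnegative L2 functions the extension is
  \<open>P t\<close> itself, up to the truncation of negative values by
  \<open>ennreal\<close>.\<close>

lemma P_eq_kernel_nn_integral:
  assumes f: "f \<in> Lp M 2" and nonneg: "\<And>x. 0 \<le> f x"
  shows "AE x in M. ennreal (P t f x) = (\<integral>\<^sup>+y. ennreal (f y) \<partial>p t x)"
proof -
  have "(\<lambda>y. ennreal (f y)) \<in> borel_measurable M" using Lp2_measurable[OF f] by simp
  hence ext: "extended_semigroup M P t (\<lambda>y. ennreal (f y)) (\<lambda>x. \<integral>\<^sup>+y. ennreal (f y) \<partial>p t x)"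
    using kernel t by (simp add: heat_kernel_def)
  show ?thesis
    using ext[unfolded extended_semigroup_def, rule_format, of "\<lambda>_. f"] f nonneg by simp
qed

text \<open>A negative value of \<open>P t f\<close> would be lost in \<open>ennreal\<close>. Adding a function \<open>g > 0\<close>, for which
  \<open>P t g > 0\<close>, excludes it.\<close>

lemma P_nonneg:
  assumes f: "f \<in> Lp M 2" and nonneg: "\<And>x. 0 \<le> f x"
  shows "AE x in M. 0 \<le> P t f x"
proof -
  obtain g :: "'a \<Rightarrow> real" where g_meas: "g \<in> borel_measurable M" and g_pos: "\<And>x. 0 < g x"
    and g_le: "\<And>x. g x \<le> 1" and g_int: "integrable M g"
    using obtain_positive_integrable_function by metis
  have "integrable M (\<lambda>x. g x * g x)"
  proof (rule Bochner_Integration.integrable_bound[OF g_int])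
    have "g x * g x \<le> g x" for x
      using mult_left_mono[OF g_le, of "g x" x] g_pos[of x] by simp
    thus "AE x in M. norm (g x * g x) \<le> norm (g x)"
      using g_pos by (simp add: less_imp_le)
  qed (use g_meas in simp)
  hence g: "g \<in> Lp M 2" using g_meas by (simp add: Lp2_iff)
  have fg: "(\<lambda>x. f x + g x) \<in> Lp M 2" using f g by (rule L2.add_mem)
  have g_nonneg: "0 \<le> g x" for x using g_pos[of x] by simp
  have fg_nonneg: "0 \<le> f x + g x" for x using g_nonneg[of x] nonneg[of x] by simp
  show ?thesis
    using P_add[OF t f g] P_eq_kernel_nn_integral[OF f nonneg]
      P_eq_kernel_nn_integral[OF g g_nonneg] P_eq_kernel_nn_integral[OF fg fg_nonneg] AE_space
  proof eventually_elim
    case (elim x)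
    interpret prob_space "p t x" using elim(5) by (rule prob_space_kernel)
    have meas: "f \<in> borel_measurable (p t x)" "g \<in> borel_measurable (p t x)"
      using Lp2_measurable[OF f] g_meas sets_kernel[OF elim(5)] by (simp_all cong: measurable_cong_sets)
    have "ennreal (g y) \<noteq> 0" for y using g_pos[of y] by (simp add: ennreal_eq_0_iff)
    hence "(\<integral>\<^sup>+y. ennreal (g y) \<partial>p t x) \<noteq> 0"
      using meas by (simp add: nn_integral_0_iff_AE AE_False)
    hence pos: "0 < P t g x" using elim(3) by (metis ennreal_neg linorder_not_le)
    have "(\<integral>\<^sup>+y. ennreal (f y + g y) \<partial>p t x) = (\<integral>\<^sup>+y. ennreal (f y) \<partial>p t x) + (\<integral>\<^sup>+y. ennreal (g y) \<partial>p t x)"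
      using meas nonneg g_nonneg by (simp add: nn_integral_add)
    hence "ennreal (P t f x + P t g x) = ennreal (P t f x) + ennreal (P t g x)"
      using elim by simp
    \<comment> \<open>For negative \<open>P t f x\<close> the right side above would be
      \<open>ennreal (P t g x)\<close>, but the left side would be strictly smaller because
      \<open>P t g x > 0\<close>.\<close>
    thus "0 \<le> P t f x"
      using ennreal_lessI[OF pos, of "P t f x + P t g x"]
      by (cases "0 \<le> P t f x") (simp_all add: ennreal_neg)
  qed
qed

text \<open>For nonnegative functions \<open>P_nonneg\<close> undoes the truncation, and finiteness
  of \<open>P t h x\<close> gives integrability. The general case splits \<open>f\<close> into
  positive and negative parts.\<close>

lemma P_eq_kernel_integral:
  assumes f: "f \<in> Lp M 2"
  shows "AE x in M. integrable (p t x) f \<and> P t f x = (\<integral>y. f y \<partial>p t x)"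
proof -
  have *: "AE x in M. integrable (p t x) h \<and> P t h x = (\<integral>y. h y \<partial>p t x)"
    if h: "h \<in> Lp M 2" and nonneg: "\<And>x. 0 \<le> h x" for h
    using P_eq_kernel_nn_integral[OF h nonneg] P_nonneg[OF h nonneg] AE_space
  proof eventually_elim
    case (elim x)
    have "h \<in> borel_measurable (p t x)"
      using Lp2_measurable[OF h] sets_kernel[OF elim(3)] by (simp cong: measurable_cong_sets)
    thus ?case
      using nn_integral_eq_integrable[of h "p t x" "P t h x"] elim nonneg by simp
  qed
  have pos: "(\<lambda>x. max 0 (h x)) \<in> Lp M 2" if "h \<in> Lp M 2" for h
  proof -
    have "integrable M (\<lambda>x. max 0 (h x) * max 0 (h x))"
      by (rule Bochner_Integration.integrable_bound[of M "\<lambda>x. h x * h x"])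
        (use that in \<open>auto simp: Lp2_iff max_def\<close>)
    thus ?thesis using that by (auto simp: Lp2_iff)
  qed
  define f1 where "f1 = (\<lambda>x. max 0 (f x))"
  define f2 where "f2 = (\<lambda>x. max 0 (- f x))"
  have f1: "f1 \<in> Lp M 2" and f2: "f2 \<in> Lp M 2"
    using pos[OF f] pos[OF L2.scale_mem[OF f, of "-1"]] by (simp_all add: f1_def f2_def)
  have f1_nonneg: "0 \<le> f1 x" and f2_nonneg: "0 \<le> f2 x" for x by (simp_all add: f1_def f2_def)
  \<comment> \<open>Written with \<open>(-1) *\<close> instead of a difference so that
    \<open>P_add\<close> and \<open>P_scale\<close> apply.\<close>
  have f_eq: "f = (\<lambda>x. f1 x + (-1) * f2 x)" by (auto simp: f1_def f2_def max_def)
  have f2': "(\<lambda>x. (-1) * f2 x) \<in> Lp M 2" using f2 by (rule L2.scale_mem)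
  have "AE x in M. P t f x = P t f1 x + P t (\<lambda>y. (-1) * f2 y) x"
    using P_add[OF t f1 f2'] by (subst f_eq)
  thus ?thesis
    using P_scale[OF t f2, of "-1"] *[OF f1 f1_nonneg] *[OF f2 f2_nonneg]
  proof eventually_elim
    case (elim x)
    have "integrable (p t x) (\<lambda>x. f1 x + (-1) * f2 x)"
      using elim by simp
    moreover have "(\<integral>y. f1 y + (-1) * f2 y \<partial>p t x) = P t f x"
      using elim by simp
    ultimately show ?case unfolding f_eq[symmetric] by simp
  qed
qed

text \<open>Both sides are inner products with \<open>P t\<close>. Stated with nonnegative integrals
  so that monotone convergence can later replace \<open>g\<close> by the constant 1.\<close>

lemma kernel_symmetric:
  assumes f: "f \<in> Lp M 2" "\<And>x. 0 \<le> f x" and g: "g \<in> Lp M 2" "\<And>x. 0 \<le> g x"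
  shows "(\<integral>\<^sup>+x. ennreal (g x) * (\<integral>\<^sup>+y. ennreal (f y) \<partial>p t x) \<partial>M) =
    (\<integral>\<^sup>+x. ennreal (f x) * (\<integral>\<^sup>+y. ennreal (g y) \<partial>p t x) \<partial>M)"
proof -
  have *: "(\<integral>\<^sup>+x. ennreal (g x) * (\<integral>\<^sup>+y. ennreal (f y) \<partial>p t x) \<partial>M) = ennreal (L2_inner M (P t f) g)"
    if f: "f \<in> Lp M 2" "\<And>x. 0 \<le> f x" and g: "g \<in> Lp M 2" "\<And>x. 0 \<le> g x" for f g
  proof -
    have "(\<integral>\<^sup>+x. ennreal (g x) * (\<integral>\<^sup>+y. ennreal (f y) \<partial>p t x) \<partial>M) = (\<integral>\<^sup>+x. ennreal (P t f x * g x) \<partial>M)"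
      using P_eq_kernel_nn_integral[OF f] P_nonneg[OF f]
      by (intro nn_integral_cong_AE) (auto elim!: eventually_elim2 simp: ennreal_mult g mult.commute)
    also have "\<dots> = ennreal (L2_inner M (P t f) g)"
      unfolding L2_inner_def using P_nonneg[OF f] P_mem[OF t f(1)] g
      by (intro nn_integral_eq_integral integrable_mult_Lp2) (auto elim!: eventually_mono)
    finally show ?thesis .
  qed
  have "L2_inner M (P t f) g = L2_inner M (P t g) f"
    using P_symmetric[OF t f(1) g(1)] L2.sym[OF f(1) P_mem[OF t g(1)]] by simp
  thus ?thesis using *[OF f g] *[OF g f] by simp
qed

text \<open>Formally, pair P_t h with 1 and use symmetry and total mass 1 of the kernels. Neither 1
  nor \<open>h\<close> need be in L2, so both are reached by increasing truncations: first 1 with an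
  L2 function fixed, then \<open>h\<close>.\<close>

lemma kernel_invariant:
  assumes h: "h \<in> borel_measurable M" and nonneg: "\<And>x. 0 \<le> h x"
  shows "(\<integral>\<^sup>+x. (\<integral>\<^sup>+y. ennreal (h y) \<partial>p t x) \<partial>M) = (\<integral>\<^sup>+x. ennreal (h x) \<partial>M)"
proof -
  obtain A :: "nat \<Rightarrow> 'a set" where A: "range A \<subseteq> sets M" "(\<Union>i. A i) = space M"
    "\<And>i. emeasure M (A i) \<noteq> \<infinity>" "incseq A"
    using sigma_finite_incseq by metis
  have A_sets [measurable]: "A n \<in> sets M" for n using A(1) by blast
  define g :: "nat \<Rightarrow> 'a \<Rightarrow> real" where "g n = indicator (A n)" for n
  have g_meas [measurable]: "g n \<in> borel_measurable M" for n
    by (simp add: g_def)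
  have g_nonneg: "0 \<le> g n x" for n x by (simp add: g_def)
  have g_mono: "g n x \<le> g m x" if "n \<le> m" for n m x
    using incseqD[OF A(4) that] by (auto simp: g_def indicator_def)
  have g_int: "integrable M (g n)" for n
    using A(3)[of n] by (simp add: g_def less_top)
  have g: "g n \<in> Lp M 2" for n
    using g_int[of n] by (simp add: Lp2_iff g_def flip: indicator_inter_arith)
  have g_SUP: "(SUP n. ennreal (g n x)) = 1" if x: "x \<in> space M" for x
  proof (rule antisym)
    show "(SUP n. ennreal (g n x)) \<le> 1"
      by (rule SUP_least) (simp add: g_def indicator_def)
    obtain n where "x \<in> A n" using A(2) x by blast
    thus "1 \<le> (SUP n. ennreal (g n x))" by (intro SUP_upper2[of n]) (auto simp: g_def)
  qed
  have inc_g: "incseq (\<lambda>n x. ennreal (g n x))"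
    by (auto simp: incseq_def le_fun_def intro!: ennreal_leI g_mono)
  have kernel_g_SUP: "(SUP n. \<integral>\<^sup>+y. ennreal (g n y) \<partial>p t x) = 1" if x: "x \<in> space M" for x
  proof -
    interpret prob_space "p t x" using x by (rule prob_space_kernel)
    have space: "space (p t x) = space M" using sets_kernel[OF x] by (rule sets_eq_imp_space_eq)
    have "(SUP n. \<integral>\<^sup>+y. ennreal (g n y) \<partial>p t x) = (\<integral>\<^sup>+y. (SUP n. ennreal (g n y)) \<partial>p t x)"
      using sets_kernel[OF x]
      by (intro nn_integral_monotone_convergence_SUP[symmetric] inc_g)
        (simp cong: measurable_cong_sets)
    also have "\<dots> = (\<integral>\<^sup>+y. 1 \<partial>p t x)"
      by (intro nn_integral_cong g_SUP) (simp add: space)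
    finally show ?thesis by (simp add: emeasure_space_1)
  qed
  have kernel_mono: "(\<integral>\<^sup>+y. ennreal (a y) \<partial>p t x) \<le> (\<integral>\<^sup>+y. ennreal (b y) \<partial>p t x)"
    if "\<And>y. a y \<le> b y" for a b :: "'a \<Rightarrow> real" and x
    by (intro nn_integral_mono ennreal_leI that)
  have L2_case: "(\<integral>\<^sup>+x. (\<integral>\<^sup>+y. ennreal (k y) \<partial>p t x) \<partial>M) = (\<integral>\<^sup>+x. ennreal (k x) \<partial>M)"
    if k: "k \<in> Lp M 2" "\<And>x. 0 \<le> k x" for k
  proof -
    note [measurable] = Lp2_measurable[OF k(1)]
    have "(\<integral>\<^sup>+x. (\<integral>\<^sup>+y. ennreal (k y) \<partial>p t x) \<partial>M) =
        (\<integral>\<^sup>+x. (SUP n. ennreal (g n x) * (\<integral>\<^sup>+y. ennreal (k y) \<partial>p t x)) \<partial>M)"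
      by (intro nn_integral_cong) (simp add: SUP_mult_right_ennreal[symmetric] g_SUP)
    also have "\<dots> = (SUP n. \<integral>\<^sup>+x. ennreal (g n x) * (\<integral>\<^sup>+y. ennreal (k y) \<partial>p t x) \<partial>M)"
      by (intro nn_integral_monotone_convergence_SUP)
        (auto simp: incseq_def le_fun_def intro!: mult_right_mono ennreal_leI g_mono)
    also have "\<dots> = (SUP n. \<integral>\<^sup>+x. ennreal (k x) * (\<integral>\<^sup>+y. ennreal (g n y) \<partial>p t x) \<partial>M)"
      using kernel_symmetric[OF k g g_nonneg] by simp
    also have "\<dots> = (\<integral>\<^sup>+x. (SUP n. ennreal (k x) * (\<integral>\<^sup>+y. ennreal (g n y) \<partial>p t x)) \<partial>M)"
      by (intro nn_integral_monotone_convergence_SUP[symmetric])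
        (auto simp: incseq_def le_fun_def intro!: mult_left_mono kernel_mono g_mono)
    also have "\<dots> = (\<integral>\<^sup>+x. ennreal (k x) \<partial>M)"
      by (intro nn_integral_cong) (simp add: SUP_mult_left_ennreal[symmetric] kernel_g_SUP)
    finally show ?thesis .
  qed
  \<comment> \<open>Capped at height n and restricted to a set of finite measure, hence in L2; both
    cutoffs disappear as n grows.\<close>
  define k where "k n x = min (h x) (real n) * g n x" for n x
  have k_meas [measurable]: "k n \<in> borel_measurable M" for n
    unfolding k_def using h by measurable
  have k_nonneg: "0 \<le> k n x" for n x using nonneg[of x] by (simp add: k_def g_nonneg)
  have k: "k n \<in> Lp M 2" for n
  proof -
    have "integrable M (\<lambda>x. k n x * k n x)"
    proof (rule Bochner_Integration.integrable_bound)
      show "integrable M (\<lambda>x. real n * real n * g n x)" using g_int by simp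
      have "k n x * k n x \<le> real n * real n * g n x" for x
        using nonneg[of x] by (auto simp: k_def g_def indicator_def intro!: mult_mono)
      thus "AE x in M. norm (k n x * k n x) \<le> norm (real n * real n * g n x)"
        by (simp add: g_nonneg k_nonneg)
    qed simp
    thus ?thesis by (simp add: Lp2_iff)
  qed
  have k_mono: "k n x \<le> k m x" if "n \<le> m" for n m x
    unfolding k_def using that g_mono[OF that, of x] nonneg[of x] g_nonneg[of n x]
    by (intro mult_mono) auto
  have k_SUP: "(SUP n. ennreal (k n x)) = ennreal (h x)" if x: "x \<in> space M" for x
  proof (rule antisym)
    show "(SUP n. ennreal (k n x)) \<le> ennreal (h x)"
      using nonneg[of x] by (intro SUP_least ennreal_leI) (auto simp: k_def g_def indicator_def)
    obtain n where n: "x \<in> A n" using A(2) x by blast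
    obtain m where m: "h x \<le> real m" using real_arch_simple by blast
    have "g (max n m) x = 1"
      using incseqD[OF A(4), of n "max n m"] n by (auto simp: g_def)
    hence "k (max n m) x = h x" using m by (simp add: k_def)
    thus "ennreal (h x) \<le> (SUP n. ennreal (k n x))" by (intro SUP_upper2[of "max n m"]) auto
  qed
  have inc_k: "incseq (\<lambda>n x. ennreal (k n x))"
    by (auto simp: incseq_def le_fun_def intro!: ennreal_leI k_mono)
  have kernel_k_SUP: "(\<integral>\<^sup>+y. ennreal (h y) \<partial>p t x) = (SUP n. \<integral>\<^sup>+y. ennreal (k n y) \<partial>p t x)"
    if x: "x \<in> space M" for x
  proof -
    have space: "space (p t x) = space M" using sets_kernel[OF x] by (rule sets_eq_imp_space_eq)
    have "(\<integral>\<^sup>+y. ennreal (h y) \<partial>p t x) = (\<integral>\<^sup>+y. (SUP n. ennreal (k n y)) \<partial>p t x)"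
      by (intro nn_integral_cong k_SUP[symmetric]) (simp add: space)
    also have "\<dots> = (SUP n. \<integral>\<^sup>+y. ennreal (k n y) \<partial>p t x)"
      using sets_kernel[OF x]
      by (intro nn_integral_monotone_convergence_SUP inc_k) (simp cong: measurable_cong_sets)
    finally show ?thesis .
  qed
  have "(\<integral>\<^sup>+x. (\<integral>\<^sup>+y. ennreal (h y) \<partial>p t x) \<partial>M) = (\<integral>\<^sup>+x. (SUP n. \<integral>\<^sup>+y. ennreal (k n y) \<partial>p t x) \<partial>M)"
    by (intro nn_integral_cong kernel_k_SUP)
  also have "\<dots> = (SUP n. \<integral>\<^sup>+x. (\<integral>\<^sup>+y. ennreal (k n y) \<partial>p t x) \<partial>M)"
    by (intro nn_integral_monotone_convergence_SUP)
      (auto simp: incseq_def le_fun_def intro!: kernel_mono k_mono)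
  also have "\<dots> = (SUP n. \<integral>\<^sup>+x. ennreal (k n x) \<partial>M)"
    using L2_case[OF k k_nonneg] by simp
  also have "\<dots> = (\<integral>\<^sup>+x. (SUP n. ennreal (k n x)) \<partial>M)"
    by (intro nn_integral_monotone_convergence_SUP[symmetric] inc_k) simp
  also have "\<dots> = (\<integral>\<^sup>+x. ennreal (h x) \<partial>M)"
    by (intro nn_integral_cong k_SUP)
  finally show ?thesis .
qed

text \<open>Expanding the square under p_t(y, dx) gives P_t(f^2) - 2 f P_t f + f^2 at y. By
  invariance the first term integrates to the squared norm of \<open>f\<close>, like the
  last.\<close>

lemma double_integral_eq_semigroup_defect:
  assumes f: "f \<in> Lp M 2"
  shows "(\<integral>\<^sup>+y. (\<integral>\<^sup>+x. ennreal ((f x - f y)\<^sup>2) \<partial>p t y) \<partial>M) = ennreal (2 * semigroup_defect M P t f f)"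
proof -
  note [measurable] = Lp2_measurable[OF f]
  \<comment> \<open>\<open>N\<close> plays the role of P_t(f^2). The square of \<open>f\<close> need
    not be in L2, so it is defined through the kernel.\<close>
  define N where "N y = (\<integral>\<^sup>+x. ennreal (f x * f x) \<partial>p t y)" for y
  have N_meas [measurable]: "N \<in> borel_measurable M" unfolding N_def by measurable
  have "(\<integral>\<^sup>+y. N y \<partial>M) = (\<integral>\<^sup>+x. ennreal (f x * f x) \<partial>M)"
    unfolding N_def by (rule kernel_invariant) simp_all
  also have "\<dots> = ennreal (L2_inner M f f)"
    unfolding L2_inner_def using f by (intro nn_integral_eq_integral) (auto simp: Lp2_iff)
  finally have N_int: "(\<integral>\<^sup>+y. N y \<partial>M) = ennreal (L2_inner M f f)" .
  \<comment> \<open>Thus \<open>enn2real\<close> loses nothing outside a null set, and the expansion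
    can be done with real integrals.\<close>
  hence N_finite: "AE y in M. N y \<noteq> \<infinity>" by (intro nn_integral_PInf_AE) auto
  have "(\<integral>\<^sup>+y. ennreal (enn2real (N y)) \<partial>M) = (\<integral>\<^sup>+y. N y \<partial>M)"
    using N_finite by (intro nn_integral_cong_AE) (auto elim!: eventually_mono simp: less_top)
  hence k: "integrable M (\<lambda>y. enn2real (N y))" "(\<integral>y. enn2real (N y) \<partial>M) = L2_inner M f f"
    using nn_integral_eq_integrable[of "\<lambda>y. enn2real (N y)" M "L2_inner M f f"] N_int L2.nonneg[OF f]
    by auto
  define w where "w y = enn2real (N y) - 2 * (P t f y * f y) + f y * f y" for y
  have int: "integrable M (\<lambda>y. P t f y * f y)" "integrable M (\<lambda>y. f y * f y)"
    using integrable_mult_Lp2[OF P_mem[OF t f] f] integrable_mult_Lp2[OF f f] by auto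
  have w_int: "integrable M w" unfolding w_def using k(1) int by simp
  have w_eq: "(\<integral>y. w y \<partial>M) = 2 * semigroup_defect M P t f f"
    unfolding w_def using k int by (simp add: semigroup_defect_def L2_inner_def)
  have *: "AE y in M. (\<integral>\<^sup>+x. ennreal ((f x - f y)\<^sup>2) \<partial>p t y) = ennreal (w y) \<and> 0 \<le> w y"
    using N_finite P_eq_kernel_integral[OF f] AE_space
  proof eventually_elim
    case (elim y)
    interpret prob_space "p t y" using elim(3) by (rule prob_space_kernel)
    have meas [measurable]: "f \<in> borel_measurable (p t y)"
      using Lp2_measurable[OF f] sets_kernel[OF elim(3)] by (simp cong: measurable_cong_sets)
    have "integrable (p t y) (\<lambda>x. f x * f x) \<and> (\<integral>x. f x * f x \<partial>p t y) = enn2real (N y)"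
      using nn_integral_eq_integrable[of "\<lambda>x. f x * f x" "p t y" "enn2real (N y)"] elim(1)
      by (simp add: N_def less_top)
    hence "integrable (p t y) (\<lambda>x. f x * f x - 2 * f y * f x + f y * f y) \<and>
        (\<integral>x. f x * f x - 2 * f y * f x + f y * f y \<partial>p t y) = w y"
      using elim(2) by (simp add: w_def prob_space)
    moreover have "(\<lambda>x. f x * f x - 2 * f y * f x + f y * f y) = (\<lambda>x. (f x - f y)\<^sup>2)"
      by (simp add: power2_eq_square algebra_simps)
    ultimately have "integrable (p t y) (\<lambda>x. (f x - f y)\<^sup>2) \<and> (\<integral>x. (f x - f y)\<^sup>2 \<partial>p t y) = w y"
      by simp
    moreover have "0 \<le> (\<integral>x. (f x - f y)\<^sup>2 \<partial>p t y)" by simp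
    ultimately show ?case
      using nn_integral_eq_integral[of "p t y" "\<lambda>x. (f x - f y)\<^sup>2"] by auto
  qed
  have "(\<integral>\<^sup>+y. (\<integral>\<^sup>+x. ennreal ((f x - f y)\<^sup>2) \<partial>p t y) \<partial>M) = (\<integral>\<^sup>+y. ennreal (w y) \<partial>M)"
    using * by (intro nn_integral_cong_AE) (auto elim!: eventually_mono)
  also have "\<dots> = ennreal (\<integral>y. w y \<partial>M)"
    using * by (intro nn_integral_eq_integral w_int) (auto elim!: eventually_mono)
  finally show ?thesis unfolding w_eq .
qed

end

text \<open>For each t the term of the supremum is the square root of twice the defect over t.
  Comparing with a real constant covers finite and infinite seminorms alike.\<close>

lemma besov_seminorm_le_iff:
  assumes f: "f \<in> Lp M 2" and c: "0 \<le> c"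
  shows "besov_seminorm M p 2 (1/2) f \<le> ennreal c \<longleftrightarrow>
    (\<forall>t>0. semigroup_defect M P t f f \<le> t * (c\<^sup>2 / 2))"
proof -
  have "ennreal (t powr - (1/2)) *
      ennreal_powr (\<integral>\<^sup>+y. (\<integral>\<^sup>+x. ennreal (\<bar>f x - f y\<bar> powr 2) \<partial>p t y) \<partial>M) (1 / 2) \<le> ennreal c
      \<longleftrightarrow> semigroup_defect M P t f f \<le> t * (c\<^sup>2 / 2)" if t: "0 < t" for t
  proof -
    define d where "d = 2 * semigroup_defect M P t f f"
    have d: "0 \<le> d"
      using nonneg_symmetric_form.nonneg[OF semigroup_defect_form f, of t] t by (simp add: d_def)
    have "(\<integral>\<^sup>+y. (\<integral>\<^sup>+x. ennreal (\<bar>f x - f y\<bar> powr 2) \<partial>p t y) \<partial>M) = ennreal d"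
      using double_integral_eq_semigroup_defect[OF _ f, of t] t by (simp add: d_def)
    hence "ennreal (t powr - (1/2)) *
        ennreal_powr (\<integral>\<^sup>+y. (\<integral>\<^sup>+x. ennreal (\<bar>f x - f y\<bar> powr 2) \<partial>p t y) \<partial>M) (1 / 2)
        = ennreal (sqrt (d / t))"
      using t d by (simp add: ennreal_powr_def powr_minus powr_half_sqrt ennreal_mult'[symmetric]
          real_sqrt_divide field_simps)
    moreover have "sqrt (d / t) \<le> c \<longleftrightarrow> d / t \<le> c\<^sup>2"
      using c real_sqrt_le_iff[of "d / t" "c\<^sup>2"] by simp
    moreover have "d / t \<le> c\<^sup>2 \<longleftrightarrow> semigroup_defect M P t f f \<le> t * (c\<^sup>2 / 2)"
      using t by (auto simp: d_def field_simps)
    ultimately show ?thesis using c by simp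
  qed
  thus ?thesis unfolding besov_seminorm_def by (simp add: SUP_le_iff Ball_def)
qed

end

section \<open>Identification of the Besov space and its seminorm\<close>

theorem proposition4p6:
  fixes M :: "'a measure"
    and E :: "('a \<Rightarrow> real) \<Rightarrow> ('a \<Rightarrow> real) \<Rightarrow> real"
    and F :: "('a \<Rightarrow> real) set"
    and P :: "real \<Rightarrow> ('a \<Rightarrow> real) \<Rightarrow> 'a \<Rightarrow> real"
    and p :: "real \<Rightarrow> 'a \<Rightarrow> 'a measure"
  assumes "dirichlet_space M E F"
    and "heat_semigroup M E F P"
    and "conservative_semigroup M P"
    and "heat_kernel M P p"
  shows "besov_space M p 2 (1/2) = F \<and>
         (\<forall>f\<in>F. ennreal (2 * E f f) = (besov_seminorm M p 2 (1/2) f)\<^sup>2)"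
proof -
  have sf: "symmetric_form M E F" and closed: "closed_form M E F" and sigma: "sigma_finite_measure M"
    using assms(1) by (auto simp: dirichlet_space_def dirichlet_form_def)
  interpret sigma_finite_measure M by (rule sigma)
  interpret markov_semigroup M P p
    by unfold_locales (use assms in \<open>auto simp: heat_semigroup_def\<close>)
  note F_subset = symmetric_form_subset[OF sf]
  \<comment> \<open>Everything follows by choosing \<open>c\<close>: a finite seminorm as
    \<open>c\<close> gives membership in \<open>F\<close> and 2 E(f, f) <= c^2, and c = sqrt(2 E(f,
    f)) gives the reverse bound.\<close>
  have le_iff: "besov_seminorm M p 2 (1/2) f \<le> ennreal c \<longleftrightarrow> f \<in> F \<and> 2 * E f f \<le> c\<^sup>2"
    if "f \<in> Lp M 2" "0 \<le> c" for f c
    using besov_seminorm_le_iff[OF that] semigroup_defect_le_iff_form_le[OF sf closed assms(2) that(1), of "c\<^sup>2 / 2"]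
    by auto
  have E_nonneg: "0 \<le> E f f" if "f \<in> F" for f
    using nonneg_symmetric_form.nonneg[OF symmetric_form_interp[OF sf] that] .
  have le: "besov_seminorm M p 2 (1/2) f \<le> ennreal (sqrt (2 * E f f))" if f: "f \<in> F" for f
    using le_iff[OF F_subset[OF f], of "sqrt (2 * E f f)"] f E_nonneg[OF f] by simp
  have "f \<in> F" if "f \<in> besov_space M p 2 (1/2)" for f
  proof -
    have "besov_seminorm M p 2 (1/2) f < \<infinity>" and f: "f \<in> Lp M 2"
      using that by (auto simp: besov_space_def)
    then obtain c where "0 \<le> c" "besov_seminorm M p 2 (1/2) f = ennreal c"
      by (metis ennreal_cases infinity_ennreal_def less_irrefl)
    thus ?thesis using le_iff[OF f, of c] by simp
  qed
  moreover have "f \<in> besov_space M p 2 (1/2)" if f: "f \<in> F" for f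
    using le_less_trans[OF le[OF f] ennreal_less_top] F_subset[OF f] by (simp add: besov_space_def)
  moreover have "ennreal (2 * E f f) = (besov_seminorm M p 2 (1/2) f)\<^sup>2" if f: "f \<in> F" for f
  proof -
    obtain c where c: "0 \<le> c" "besov_seminorm M p 2 (1/2) f = ennreal c"
      using le[OF f] by (metis ennreal_cases ennreal_neq_top top.extremum_uniqueI)
    have "2 * E f f \<le> c\<^sup>2" using le_iff[OF F_subset[OF f] c(1)] c(2) by simp
    moreover have "c \<le> sqrt (2 * E f f)"
      using le[OF f] c E_nonneg[OF f] by simp
    hence "c\<^sup>2 \<le> 2 * E f f"
      using power_mono[OF _ c(1), of "sqrt (2 * E f f)" 2] E_nonneg[OF f] by simp
    ultimately have "2 * E f f = c\<^sup>2" by simp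
    thus ?thesis using c by (simp add: ennreal_power)
  qed
  ultimately show ?thesis by blast
qed

end
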